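(* Consider non-oriented homogeneous bond Bernoulli percolation on $\mathbb{Z}^d$, with critical point $p_c^b(d)$. For $d\ge 3$ let $p^{\ast}(d)$ be the unique solution $p\in(0,1)$ of $$\prod_{i=0}^2 \left(1-(1-p)^{\lfloor\frac{d+i}{3}\rfloor}\right)=2-\sum_{i=0}^2(1-p)^{\lfloor\frac{d+i}{3}\rfloor}.$$ Then, for every $d\geq 3$, we have $p_c^b(d) \leq p^{\ast}(d)$.
   Context: For $x\in\mathbb{R}$, $\lfloor x\rfloor$ is the largest integer smaller than or equal to $x$. The graph $\mathbb{Z}^d$ has vertex set $\mathbb{Z}^d$ and edge set $E(\mathbb{Z}^d)$, the set of unordered pairs $\langle v,u\rangle$ with $v,u\in\mathbb{Z}^d$ and $|v-u|=1$ (nearest-neighbour hypercubic lattice). In bond Bernoulli percolation with parameter $p\in[0,1]$, the edges are independently open with probability $p$ and closed with probability $1-p$; $\mathbb{P}_p$ is the resulting product measure. For vertices $x,y$, write $x\leftrightarrow y$ if there are $x_0=x,x_1,\dots,x_n=y$ such that each $\langle x_{j-1},x_j\rangle$, $j=1,\dots,n$, belongs to $E(\mathbb{Z}^d)$ and is open. Let $\mathcal{C}^b_0=\{x\in\mathbb{Z}^d: 0\leftrightarrow x\}$, $\theta^b_d(p)=\mathbb{P}_p(|\mathcal{C}^b_0|=\infty)$, and $p_c^b(d)=\sup\{p\in[0,1]:\theta^b_d(p)=0\}$. *)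

theory Defs
  imports "HOL-Probability.Probability"
begin

text \<open>
  The dimension \<open>d\<close> is an ordinary natural number, so a vertex of the lattice is a function on
  the naturals that vanishes from index \<open>d\<close> on. An unordered pair is the two-element set of its
  endpoints, and a configuration maps each edge to whether it is open.
\<close>

type_synonym vertex = "nat \<Rightarrow> int"
type_synonym edge = "vertex set"
type_synonym config = "edge \<Rightarrow> bool"

definition lattice :: "nat \<Rightarrow> vertex set" where
  "lattice d = {v. \<forall>i\<ge>d. v i = 0}"

definition lattice_dist :: "nat \<Rightarrow> vertex \<Rightarrow> vertex \<Rightarrow> int" where
  "lattice_dist d v u = (\<Sum>i<d. \<bar>v i - u i\<bar>)"

definition lattice_edges :: "nat \<Rightarrow> edge set" where
  "lattice_edges d = {{v, u} | v u. v \<in> lattice d \<and> u \<in> lattice d \<and> lattice_dist d v u = 1}"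

definition bond_measure :: "nat \<Rightarrow> real \<Rightarrow> config measure" where
  "bond_measure d p = (\<Pi>\<^sub>M e\<in>lattice_edges d. measure_pmf (bernoulli_pmf p))"

definition connected_in :: "nat \<Rightarrow> config \<Rightarrow> vertex \<Rightarrow> vertex \<Rightarrow> bool" where
  "connected_in d \<omega> x y \<longleftrightarrow>
     (\<exists>(n::nat) (xs :: nat \<Rightarrow> vertex). xs 0 = x \<and> xs n = y \<and>
        (\<forall>j\<in>{1..n}. {xs (j - 1), xs j} \<in> lattice_edges d \<and> \<omega> {xs (j - 1), xs j}))"

definition open_cluster :: "nat \<Rightarrow> config \<Rightarrow> vertex set" where
  "open_cluster d \<omega> = {x \<in> lattice d. connected_in d \<omega> (\<lambda>_. 0) x}"

definition theta_bond :: "nat \<Rightarrow> real \<Rightarrow> real" where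
  "theta_bond d p =
     measure (bond_measure d p) {\<omega> \<in> space (bond_measure d p). infinite (open_cluster d \<omega>)}"

definition pc_bond :: "nat \<Rightarrow> real" where
  "pc_bond d = Sup {p \<in> {0..1}. theta_bond d p = 0}"

definition pstar_equation :: "nat \<Rightarrow> real \<Rightarrow> bool" where
  "pstar_equation d p \<longleftrightarrow>
     (\<Prod>i\<in>{0..2::nat}. 1 - (1 - p) ^ nat \<lfloor>(real d + real i) / 3\<rfloor>)
       = 2 - (\<Sum>i\<in>{0..2::nat}. (1 - p) ^ nat \<lfloor>(real d + real i) / 3\<rfloor>)"

definition pstar :: "nat \<Rightarrow> real" where
  "pstar d = (THE p. p \<in> {0<..<1} \<and> pstar_equation d p)"

end

theory Submission
  imports Defs "HOL-Library.Z2"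
begin

text \<open>
  The map \<open>proj d\<close> folds \<open>\<int>\<^sup>d\<close> onto the triangular lattice, the coordinates congruent to \<open>k\<close> modulo 3
  going to the \<open>k\<close>-th direction. Exploring a cluster edge by edge shows that the cluster in the triangular
  lattice, with an edge of direction \<open>k\<close> open with probability \<open>q\<^sub>k = 1 - (1 - p)^n\<^sub>k\<close>, is dominated by
  the projected cluster of \<open>\<int>\<^sup>d\<close>. The equation for \<open>p\<^sup>*\<close> is the critical surface
  \<open>q\<^sub>0 + q\<^sub>1 + q\<^sub>2 - q\<^sub>0 q\<^sub>1 q\<^sub>2 = 1\<close> of the triangular lattice.

  Sharpness of the transition is used in the form of Duminil-Copin and Tassion, with the functional \<open>\<phi>\<^sub>p(S)\<close>
  counting the expected number of open boundary edges of \<open>S\<close> reached from the origin inside \<open>S\<close>. If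
  \<open>\<phi>\<^sub>p(S) < 1\<close> for some finite \<open>S\<close>, connection probabilities decay exponentially in \<open>\<int>\<^sup>d\<close>, hence in the
  triangular lattice. On and above the critical surface the star-triangle transformation bounds the closed
  dual edges (a hexagonal lattice) by the same triangular model, so they decay exponentially too. But in
  every box either the open edges cross from left to right or the closed dual edges cross from bottom to
  top, a contradiction. So \<open>\<phi>\<^sub>p(S) \<ge> 1\<close> for all \<open>p \<ge> p\<^sup>*\<close> and all finite \<open>S\<close> containing the origin,
  and the differential inequality \<open>\<theta>' \<ge> 1 - \<theta>\<close> for exit probabilities from finite boxes gives
  \<open>\<theta>(p) \<ge> 1 - e^(p\<^sup>* - p)\<close>.
\<close>

section \<open>Finite Bernoulli expectations\<close>

text \<open>Expectation over a random subset of a finite edge set, a configuration being the set of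
  its open edges. A finite sum raises no question of measurability; \<open>bond_window_sets\<close>
  links it to the product measure. The probability may depend on the edge, as the three directions
  of the triangular lattice have different ones.\<close>

definition bexp :: "('e \<Rightarrow> real) \<Rightarrow> 'e set \<Rightarrow> ('e set \<Rightarrow> real) \<Rightarrow> real" where
  "bexp q F f = (\<Sum>\<omega>\<in>Pow F. (\<Prod>e\<in>F. if e \<in> \<omega> then q e else 1 - q e) * f \<omega>)"

lemma bexp_empty [simp]: "bexp q {} f = f {}"
  by (simp add: bexp_def)

lemma bexp_insert:
  assumes "finite F" "e \<notin> F"
  shows "bexp q (insert e F) f =
    q e * bexp q F (\<lambda>\<omega>. f (insert e \<omega>)) + (1 - q e) * bexp q F f"
proof -
  let ?w = "\<lambda>G \<omega>. \<Prod>e\<in>G. if e \<in> \<omega> then q e else 1 - q e"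
  have inj: "inj_on (insert e) (Pow F)"
    using assms by (auto simp: inj_on_def)
  have "?w F (insert e \<omega>) = ?w F \<omega>" for \<omega>
    using assms by (intro prod.cong) auto
  hence "(\<Sum>\<omega>\<in>insert e ` Pow F. ?w (insert e F) \<omega> * f \<omega>)
      = q e * bexp q F (\<lambda>\<omega>. f (insert e \<omega>))"
    using assms by (simp add: sum.reindex[OF inj] bexp_def sum_distrib_left algebra_simps)
  moreover have "?w (insert e F) \<omega> = (1 - q e) * ?w F \<omega>" if "\<omega> \<in> Pow F" for \<omega>
    using assms that by auto
  hence "(\<Sum>\<omega>\<in>Pow F. ?w (insert e F) \<omega> * f \<omega>) = (1 - q e) * bexp q F f"
    unfolding bexp_def sum_distrib_left by (intro sum.cong) (simp_all only: mult.assoc)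
  moreover have "Pow F \<inter> insert e ` Pow F = {}"
    using assms by auto
  ultimately show ?thesis
    unfolding bexp_def[of q "insert e F"] Pow_insert
    using assms by (subst sum.union_disjoint) auto
qed

lemma bexp_cong:
  assumes "\<And>\<omega>. \<omega> \<subseteq> F \<Longrightarrow> f \<omega> = g \<omega>"
  shows "bexp q F f = bexp q F g"
  using assms by (auto simp: bexp_def intro!: sum.cong)

lemma bexp_add: "bexp q F (\<lambda>\<omega>. f \<omega> + g \<omega>) = bexp q F f + bexp q F g"
  by (simp add: bexp_def sum.distrib algebra_simps)

lemma bexp_diff: "bexp q F (\<lambda>\<omega>. f \<omega> - g \<omega>) = bexp q F f - bexp q F g"
  by (simp add: bexp_def sum_subtractf algebra_simps)

lemma bexp_cmult: "bexp q F (\<lambda>\<omega>. c * f \<omega>) = c * bexp q F f"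
  unfolding bexp_def sum_distrib_left by (intro sum.cong) auto

lemma bexp_cmult_right: "bexp q F (\<lambda>\<omega>. f \<omega> * c) = bexp q F f * c"
  unfolding bexp_def sum_distrib_right by (intro sum.cong) auto

lemma bexp_sum: "bexp q F (\<lambda>\<omega>. \<Sum>i\<in>I. f i \<omega>) = (\<Sum>i\<in>I. bexp q F (f i))"
  unfolding bexp_def sum_distrib_left by (rule sum.swap)

lemma bexp_const: "finite F \<Longrightarrow> bexp q F (\<lambda>_. c) = c"
  by (induction F rule: finite_induct) (simp_all add: bexp_insert algebra_simps)

lemma bexp_mono:
  assumes "range q \<subseteq> {0..1}" "\<And>\<omega>. \<omega> \<subseteq> F \<Longrightarrow> f \<omega> \<le> g \<omega>"
  shows "bexp q F f \<le> bexp q F g"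
proof -
  have "0 \<le> q e" "q e \<le> 1" for e
    using assms(1) by (auto simp: image_subset_iff)
  thus ?thesis
    unfolding bexp_def using assms(2)
    by (intro sum_mono mult_left_mono prod_nonneg) auto
qed

lemma bexp_Un:
  assumes "finite F" "finite G" "F \<inter> G = {}"
  shows "bexp q (F \<union> G) f = bexp q F (\<lambda>\<omega>. bexp q G (\<lambda>\<eta>. f (\<omega> \<union> \<eta>)))"
  using assms
  by (induction F arbitrary: f rule: finite_induct) (simp_all add: bexp_insert)

lemma bexp_restrict:
  assumes "finite F" "G \<subseteq> F"
  shows "bexp q F (\<lambda>\<omega>. f (\<omega> \<inter> G)) = bexp q G f"
proof -
  have fin: "finite G" "finite (F - G)"
    using assms finite_subset by auto
  have "bexp q (G \<union> (F - G)) (\<lambda>\<omega>. f (\<omega> \<inter> G))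
      = bexp q G (\<lambda>\<omega>. bexp q (F - G) (\<lambda>\<eta>. f ((\<omega> \<union> \<eta>) \<inter> G)))"
    using fin by (intro bexp_Un) auto
  also have "\<dots> = bexp q G (\<lambda>\<omega>. bexp q (F - G) (\<lambda>\<eta>. f \<omega>))"
    by (intro bexp_cong arg_cong[where f = f]) auto
  also have "\<dots> = bexp q G f"
    using fin by (simp add: bexp_const)
  finally show ?thesis
    using assms by (simp add: Un_absorb1)
qed

lemma bexp_indep:
  assumes "finite F" "A \<subseteq> F" "B \<subseteq> F" "A \<inter> B = {}"
  shows "bexp q F (\<lambda>\<omega>. f (\<omega> \<inter> A) * g (\<omega> \<inter> B)) = bexp q A f * bexp q B g"
proof -
  have fin: "finite A" "finite (F - A)"
    using assms finite_subset by auto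
  have BA: "bexp q (F - A) (\<lambda>\<eta>. g (\<eta> \<inter> B)) = bexp q B g"
    using assms fin by (intro bexp_restrict) auto
  have "bexp q (A \<union> (F - A)) (\<lambda>\<omega>. f (\<omega> \<inter> A) * g (\<omega> \<inter> B))
      = bexp q A (\<lambda>\<omega>. bexp q (F - A) (\<lambda>\<eta>. f ((\<omega> \<union> \<eta>) \<inter> A) * g ((\<omega> \<union> \<eta>) \<inter> B)))"
    using fin by (intro bexp_Un) auto
  also have "\<dots> = bexp q A (\<lambda>\<omega>. bexp q (F - A) (\<lambda>\<eta>. f \<omega> * g (\<eta> \<inter> B)))"
    using assms by (intro bexp_cong arg_cong2[where f = "(*)"] arg_cong[where f = f] arg_cong[where f = g]) auto
  also have "\<dots> = bexp q A f * bexp q B g"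
    by (simp add: bexp_cmult bexp_cmult_right BA)
  finally show ?thesis
    using assms by (simp add: Un_absorb1)
qed

lemma bexp_mono_set:
  assumes "range q \<subseteq> {0..1}" "finite F" "G \<subseteq> F" "mono f"
  shows "bexp q G f \<le> bexp q F f"
proof -
  have "bexp q F (\<lambda>\<omega>. f (\<omega> \<inter> G)) \<le> bexp q F f"
    using assms by (intro bexp_mono) (auto intro: monoD)
  thus ?thesis
    using assms by (simp add: bexp_restrict)
qed

lemma bexp_image:
  assumes "inj_on h F" "\<And>e. e \<in> F \<Longrightarrow> q (h e) = r e"
  shows "bexp q (h ` F) f = bexp r F (\<lambda>\<omega>. f (h ` \<omega>))"
proof -
  have inj: "inj_on ((`) h) (Pow F)"
    using assms(1) by (rule inj_on_image_Pow)
  have "(\<Prod>e\<in>F. if h e \<in> h ` \<omega> then q (h e) else 1 - q (h e))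
      = (\<Prod>e\<in>F. if e \<in> \<omega> then r e else 1 - r e)" if "\<omega> \<subseteq> F" for \<omega>
    using that assms by (intro prod.cong) (auto dest: inj_onD)
  thus ?thesis
    unfolding bexp_def image_Pow_surj[OF refl, symmetric] sum.reindex[OF inj] o_def
      prod.reindex[OF assms(1)]
    by (intro sum.cong) auto
qed

text \<open>Russo's formula: for the indicator of an increasing event the summand is the probability
  that e is pivotal. The induction applies the product rule to \<open>bexp_insert\<close>.\<close>

lemma bexp_has_real_derivative:
  assumes "finite F"
  shows "((\<lambda>p. bexp (\<lambda>_. p) F f) has_real_derivative
     (\<Sum>e\<in>F. bexp (\<lambda>_. p) (F - {e}) (\<lambda>\<omega>. f (insert e \<omega>) - f \<omega>))) (at p)"
  using assms
proof (induction F arbitrary: f rule: finite_induct)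
  case empty
  thus ?case by simp
next
  case (insert e F)
  let ?E = "bexp (\<lambda>_. p)"
  let ?D = "\<lambda>f. \<Sum>g\<in>F. ?E (F - {g}) (\<lambda>\<omega>. f (insert g \<omega>) - f \<omega>)"
  let ?f = "\<lambda>\<omega>. f (insert e \<omega>)"
  have deriv: "((\<lambda>p. p * bexp (\<lambda>_. p) F ?f + (1 - p) * bexp (\<lambda>_. p) F f) has_real_derivative
      (?E F ?f - ?E F f + (p * ?D ?f + (1 - p) * ?D f))) (at p)"
    by (rule derivative_eq_intros insert.IH refl | simp)+
  have "?E (insert e F - {g}) (\<lambda>\<omega>. f (insert g \<omega>) - f \<omega>)
      = p * ?E (F - {g}) (\<lambda>\<omega>. ?f (insert g \<omega>) - ?f \<omega>)
        + (1 - p) * ?E (F - {g}) (\<lambda>\<omega>. f (insert g \<omega>) - f \<omega>)" if "g \<in> F" for g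
  proof -
    have "insert e F - {g} = insert e (F - {g})"
      using that insert.hyps by auto
    thus ?thesis
      using insert.hyps by (simp add: bexp_insert insert_commute)
  qed
  moreover have "insert e F - {e} = F"
    using insert.hyps by auto
  ultimately have "(\<Sum>g\<in>insert e F. ?E (insert e F - {g}) (\<lambda>\<omega>. f (insert g \<omega>) - f \<omega>))
      = ?E F ?f - ?E F f + (p * ?D ?f + (1 - p) * ?D f)"
    using insert.hyps by (simp add: sum.distrib sum_distrib_left bexp_diff[of _ F])
  moreover have "bexp (\<lambda>_. p) (insert e F) f = p * bexp (\<lambda>_. p) F ?f + (1 - p) * bexp (\<lambda>_. p) F f" for p
    using insert.hyps by (rule bexp_insert)
  ultimately show ?case
    using deriv by simp
qed

section \<open>Connectivity\<close>

text \<open>Edges are names with an end map \<epsilon>, so that one notion serves both the cubic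
  lattice, whose edges are their own end sets, and the triangular lattice, whose edges are indexed
  by direction and base point.\<close>

definition link :: "('e \<Rightarrow> 'v set) \<Rightarrow> 'e set \<Rightarrow> 'v rel" where
  "link \<epsilon> \<omega> = {(x, y). \<exists>e\<in>\<omega>. \<epsilon> e = {x, y}}"

text \<open>The start is a set because an exploration enlarges it by the vertices found so
  far.\<close>

definition reach :: "'v rel \<Rightarrow> 'v set \<Rightarrow> 'v set \<Rightarrow> bool" where
  "reach R W T \<longleftrightarrow> (\<exists>x\<in>W. \<exists>y\<in>T. (x, y) \<in> R\<^sup>*)"

lemma link_mono: "\<omega> \<subseteq> \<eta> \<Longrightarrow> link \<epsilon> \<omega> \<subseteq> link \<epsilon> \<eta>"
  by (auto simp: link_def)

lemma reach_mono:
  "\<lbrakk>reach R W T; R \<subseteq> R'\<^sup>*; W \<subseteq> W'; T \<subseteq> T'\<rbrakk> \<Longrightarrow> reach R' W' T'"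
  using rtrancl_subset_rtrancl[of R R'] unfolding reach_def by blast

lemma reach_link_mono: "\<lbrakk>reach (link \<epsilon> \<omega>) W T; \<omega> \<subseteq> \<eta>\<rbrakk> \<Longrightarrow> reach (link \<epsilon> \<eta>) W T"
  by (erule reach_mono) (use link_mono[of \<omega> \<eta> \<epsilon>] in auto)

lemma reach_insert:
  assumes "(a, b) \<in> R\<^sup>*" "a \<in> W"
  shows "reach R (insert b W) T \<longleftrightarrow> reach R W T"
  using assms unfolding reach_def by (auto intro: rtrancl_trans)

lemma reach_invariant:
  assumes "reach R W T" "\<And>x y. \<lbrakk>x \<in> W; (x, y) \<in> R\<rbrakk> \<Longrightarrow> y \<in> W"
  shows "W \<inter> T \<noteq> {}"
proof -
  obtain x y where "x \<in> W" "y \<in> T" "(x, y) \<in> R\<^sup>*"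
    using assms(1) by (auto simp: reach_def)
  moreover from this(3,1) have "y \<in> W"
    by (induction rule: rtrancl_induct) (use assms(2) in auto)
  ultimately show ?thesis by auto
qed

text \<open>
  The cluster of \<open>W\<close> is explored one edge at a time: when the edge from \<open>a\<close> to \<open>b\<close> is revealed, the lifts
  starting at one lift of \<open>a\<close> are revealed together, and none of them was examined before because they
  lie above that edge only.
\<close>

lemma bexp_reach_le_lift:
  fixes \<epsilon> :: "'e \<Rightarrow> 'v set" and \<pi> :: "'w \<Rightarrow> 'v" and E :: "'w set set" and V :: "'w set"
  assumes q: "range q \<subseteq> {0..1}" and p: "p \<in> {0..1}"
    and inj: "inj_on \<epsilon> F0"
    and lift: "\<And>e x a b. \<lbrakk>e \<in> F0; \<epsilon> e = {a, b}; x \<in> V; \<pi> x = a\<rbrakk> \<Longrightarrow>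
      \<exists>N. finite N \<and> N \<subseteq> E \<and> (\<forall>g\<in>N. \<exists>y\<in>V. g = {x, y} \<and> \<pi> y = b) \<and> (1 - p) ^ card N \<le> 1 - q e"
    and "finite F" "F \<subseteq> F0" "W' \<subseteq> V" "W \<subseteq> \<pi> ` W'"
  shows "\<exists>E'. finite E' \<and> E' \<subseteq> {g \<in> E. \<pi> ` g \<in> \<epsilon> ` F} \<and>
    bexp q F (\<lambda>\<omega>. of_bool (reach (link \<epsilon> \<omega>) W T))
      \<le> bexp (\<lambda>_. p) E' (\<lambda>\<omega>. of_bool (reach (link (\<lambda>e. e) \<omega>) W' (\<pi> -` T)))"
  using assms(5-)
proof (induction "card F" arbitrary: F W W')
  case 0
  hence [simp]: "F = {}" by simp
  have "link (\<lambda>e. e) {} = {}" "link \<epsilon> {} = {}"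
    by (auto simp: link_def)
  thus ?case
    using 0 by (intro exI[of _ "{}"]) (fastforce simp: reach_def)
next
  case (Suc n)
  let ?P = "\<lambda>W \<omega>. of_bool (reach (link \<epsilon> \<omega>) W T) :: real"
  let ?Q = "\<lambda>W' \<omega>. of_bool (reach (link (\<lambda>e. e) \<omega>) W' (\<pi> -` T)) :: real"
  have pr: "range (\<lambda>_::'w set. p) \<subseteq> {0..1}"
    using p by auto
  \<comment> \<open>One step of the exploration: the target is already met, or no edge of F leaves
    W, or some edge leads from W to a new vertex b.\<close>
  consider (hit) "W \<inter> T \<noteq> {}" | (stuck) "W \<inter> T = {}" "\<And>e a b. \<lbrakk>e \<in> F; \<epsilon> e = {a, b}; a \<in> W\<rbrakk> \<Longrightarrow> b \<in> W"
    | (step) e a b where "e \<in> F" "\<epsilon> e = {a, b}" "a \<in> W" "b \<notin> W"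
    by blast
  thus ?case
  proof cases
    case hit
    then obtain x where "x \<in> W'" "\<pi> x \<in> T"
      using Suc.prems by blast
    hence "?Q W' {} = 1"
      by (auto simp: reach_def)
    moreover have "bexp q F (?P W) \<le> bexp q F (\<lambda>_. 1)"
      using q by (intro bexp_mono) auto
    ultimately show ?thesis
      using Suc.prems by (intro exI[of _ "{}"]) (simp add: bexp_const)
  next
    case stuck
    have "\<not> reach (link \<epsilon> \<omega>) W T" if "\<omega> \<subseteq> F" for \<omega>
      using reach_invariant[of "link \<epsilon> \<omega>" W T] stuck that unfolding link_def by blast
    hence "bexp q F (?P W) = bexp q F (\<lambda>_. 0)"
      by (intro bexp_cong) auto
    thus ?thesis
      using Suc.prems by (intro exI[of _ "{}"]) (simp add: bexp_const)
  next
    case step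
    define F' where "F' = F - {e}"
    have F: "F = insert e F'" "e \<notin> F'" "finite F'" "F' \<subseteq> F0" "card F' = n"
      using step Suc by (auto simp: F'_def)
    obtain x where x: "x \<in> W'" "\<pi> x = a"
      using step Suc.prems by blast
    obtain N where N: "finite N" "N \<subseteq> E" "\<And>g. g \<in> N \<Longrightarrow> \<exists>y\<in>V. g = {x, y} \<and> \<pi> y = b"
      "(1 - p) ^ card N \<le> 1 - q e"
      using lift[of e a b x] step(1,2) x Suc.prems by (meson subsetD)
    obtain y where y: "\<And>g. g \<in> N \<Longrightarrow> y g \<in> V \<and> g = {x, y g} \<and> \<pi> (y g) = b"
      using N(3) by metis
    \<comment> \<open>A and B are the probabilities that remain once e is found open, so that b
      joins the start, or closed.\<close>
    define A where "A = bexp q F' (?P (insert b W))"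
    define B where "B = bexp q F' (?P W)"
    have "\<exists>E'. finite E' \<and> E' \<subseteq> {g \<in> E. \<pi> ` g \<in> \<epsilon> ` F'} \<and> A \<le> bexp (\<lambda>_. p) E' (?Q (insert (y g) W'))"
      if "g \<in> N" for g
    proof -
      have "insert (y g) W' \<subseteq> V" "insert b W \<subseteq> \<pi> ` insert (y g) W'"
        using Suc.prems y[OF that] by auto
      thus ?thesis
        unfolding A_def using F by (intro Suc.hyps(1)) simp_all
    qed
    hence "\<forall>g\<in>N. \<exists>E'. finite E' \<and> E' \<subseteq> {g \<in> E. \<pi> ` g \<in> \<epsilon> ` F'} \<and> A \<le> bexp (\<lambda>_. p) E' (?Q (insert (y g) W'))"
      by blast
    from bchoice[OF this] obtain G where "\<forall>g\<in>N. finite (G g) \<and> G g \<subseteq> {g \<in> E. \<pi> ` g \<in> \<epsilon> ` F'} \<and>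
        A \<le> bexp (\<lambda>_. p) (G g) (?Q (insert (y g) W'))"
      by (elim exE)
    hence G: "finite (G g)" "G g \<subseteq> {g \<in> E. \<pi> ` g \<in> \<epsilon> ` F'}"
        "A \<le> bexp (\<lambda>_. p) (G g) (?Q (insert (y g) W'))" if "g \<in> N" for g
      using that by auto
    have "\<exists>E'. finite E' \<and> E' \<subseteq> {g \<in> E. \<pi> ` g \<in> \<epsilon> ` F'} \<and> B \<le> bexp (\<lambda>_. p) E' (?Q W')"
      unfolding B_def using F Suc.prems by (intro Suc.hyps(1)) simp_all
    then obtain G0 where G0: "finite G0" "G0 \<subseteq> {g \<in> E. \<pi> ` g \<in> \<epsilon> ` F'}" "B \<le> bexp (\<lambda>_. p) G0 (?Q W')"
      by blast
    \<comment> \<open>The induction hypothesis yields one edge set for each lift in N and one for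
      the closed case; by monotonicity their union serves all of them.\<close>
    define E' where "E' = G0 \<union> \<Union>(G ` N)"
    have E': "finite E'" "E' \<subseteq> {g \<in> E. \<pi> ` g \<in> \<epsilon> ` F'}"
      unfolding E'_def using G(1) G0(1) N(1) by (blast, intro Un_least UN_least G(2) G0(2))
    \<comment> \<open>Edges of E' lie above edges of F' and those of N above e; injectivity of
      \<epsilon> keeps the two families disjoint, hence independent.\<close>
    have "\<epsilon> e \<notin> \<epsilon> ` F'"
      using inj F Suc.prems by (metis inj_on_image_mem_iff insert_subset)
    moreover have "\<pi> ` g = \<epsilon> e" if g: "g \<in> N" for g
    proof -
      obtain z where "g = {x, z}" "\<pi> z = b"
        using N(3)[OF g] by blast
      thus ?thesis
        using x step by simp
    qed
    ultimately have disj: "N \<inter> E' = {}" and NE: "N \<subseteq> {g \<in> E. \<pi> ` g \<in> \<epsilon> ` F}"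
      using E' N(2) F by auto
    have mono: "mono (?Q W)" for W
      by (auto simp: mono_def intro: reach_link_mono)
    have BA: "B \<le> A"
      unfolding A_def B_def using q by (intro bexp_mono) (auto elim!: reach_mono)
    have inner: "(if \<eta> = {} then B else A) \<le> bexp (\<lambda>_. p) E' (\<lambda>\<omega>. ?Q W' (\<eta> \<union> \<omega>))" if \<eta>: "\<eta> \<subseteq> N" for \<eta>
    proof (cases "\<eta> = {}")
      case True
      have "B \<le> bexp (\<lambda>_. p) G0 (?Q W')" by fact
      also have "\<dots> \<le> bexp (\<lambda>_. p) E' (?Q W')"
        using E' by (intro bexp_mono_set pr mono) (auto simp: E'_def)
      finally show ?thesis
        using True by simp
    next
      case False
      then obtain g where g: "g \<in> \<eta>" "g \<in> N"
        using \<eta> by auto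
      have "A \<le> bexp (\<lambda>_. p) (G g) (?Q (insert (y g) W'))"
        using G g by auto
      also have "\<dots> \<le> bexp (\<lambda>_. p) E' (?Q (insert (y g) W'))"
        using E' g by (intro bexp_mono_set pr mono) (auto simp: E'_def)
      also have "\<dots> \<le> bexp (\<lambda>_. p) E' (\<lambda>\<omega>. ?Q W' (\<eta> \<union> \<omega>))"
      proof (intro bexp_mono pr)
        fix \<omega>
        have "(x, y g) \<in> link (\<lambda>e. e) (\<eta> \<union> \<omega>)"
          using y[OF g(2)] g(1) by (auto simp: link_def)
        hence "reach (link (\<lambda>e. e) (\<eta> \<union> \<omega>)) (insert (y g) W') (\<pi> -` T) \<longleftrightarrow> reach (link (\<lambda>e. e) (\<eta> \<union> \<omega>)) W' (\<pi> -` T)"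
          using x by (intro reach_insert) auto
        thus "?Q (insert (y g) W') \<omega> \<le> ?Q W' (\<eta> \<union> \<omega>)"
          using reach_link_mono[of "\<lambda>e. e" \<omega> "insert (y g) W'" "\<pi> -` T" "\<eta> \<union> \<omega>"] by auto
      qed
      finally show ?thesis
        using False by simp
    qed
    \<comment> \<open>A is collected unless every lift in N is closed, which has probability
      \<open>(1 - p) ^ card N\<close>.\<close>
    have weight: "bexp (\<lambda>_. p) N (\<lambda>\<eta>. if \<eta> = {} then B else A) = A - (1 - p) ^ card N * (A - B)"
      using N(1)
    proof (induction N rule: finite_induct)
      case (insert g N)
      show ?case
        unfolding bexp_insert[OF insert.hyps(1,2)]
        using insert.hyps by (simp add: insert.IH bexp_const algebra_simps)
    qed simp
    have "bexp q F (?P W) = q e * bexp q F' (\<lambda>\<omega>. ?P W (insert e \<omega>)) + (1 - q e) * B"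
      unfolding F(1) B_def using F by (intro bexp_insert) auto
    also have "\<dots> \<le> q e * A + (1 - q e) * B"
    proof -
      \<comment> \<open>With b among the starting points both ends of e are present, so opening e
        reaches nothing new.\<close>
      have "reach (link \<epsilon> \<omega>) (insert b W) T" if r: "reach (link \<epsilon> (insert e \<omega>)) W T" for \<omega>
      proof (rule ccontr)
        let ?W = "(link \<epsilon> \<omega>)\<^sup>* `` insert b W"
        assume "\<not> reach (link \<epsilon> \<omega>) (insert b W) T"
        hence "?W \<inter> T = {}"
          by (auto simp: reach_def)
        moreover have "reach (link \<epsilon> (insert e \<omega>)) ?W T"
          using r by (rule reach_mono) auto
        moreover have "v \<in> ?W" if "u \<in> ?W" "(u, v) \<in> link \<epsilon> (insert e \<omega>)" for u v
        proof (cases "(u, v) \<in> link \<epsilon> \<omega>")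
          case False
          hence "v \<in> {a, b}"
            using that step(2) by (auto simp: link_def doubleton_eq_iff)
          thus ?thesis
            using step(3) by auto
        qed (use that in \<open>meson Image_iff rtrancl.rtrancl_into_rtrancl\<close>)
        ultimately show False
          using reach_invariant[of "link \<epsilon> (insert e \<omega>)" ?W T] by blast
      qed
      hence "bexp q F' (\<lambda>\<omega>. ?P W (insert e \<omega>)) \<le> A"
        unfolding A_def using q by (intro bexp_mono) auto
      moreover have "0 \<le> q e"
        using q by (auto simp: image_subset_iff)
      ultimately show ?thesis
        by (simp add: mult_left_mono)
    qed
    also have "\<dots> = A - (1 - q e) * (A - B)"
      by (simp add: algebra_simps)
    also have "\<dots> \<le> A - (1 - p) ^ card N * (A - B)"
      using N(4) BA by (simp add: mult_right_mono)
    also have "\<dots> = bexp (\<lambda>_. p) N (\<lambda>\<eta>. if \<eta> = {} then B else A)"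
      by (simp add: weight)
    also have "\<dots> \<le> bexp (\<lambda>_. p) N (\<lambda>\<eta>. bexp (\<lambda>_. p) E' (\<lambda>\<omega>. ?Q W' (\<eta> \<union> \<omega>)))"
      by (intro bexp_mono pr inner)
    also have "\<dots> = bexp (\<lambda>_. p) (N \<union> E') (?Q W')"
      using N E' disj by (intro bexp_Un[symmetric])
    finally show ?thesis
      using N(1) E' NE F by (intro exI[of _ "N \<union> E'"]) auto
  qed
qed

section \<open>Sharpness of the phase transition\<close>

locale locally_finite_graph =
  fixes E :: "'v set set"
  assumes edge_ends: "e \<in> E \<Longrightarrow> \<exists>x y. x \<noteq> y \<and> e = {x, y}"
    and locally_finite: "finite {e \<in> E. x \<in> e}"
begin

definition inner :: "'v set \<Rightarrow> 'v set set" where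
  "inner S = {e \<in> E. e \<subseteq> S}"

definition touching :: "'v set \<Rightarrow> 'v set set" where
  "touching S = {e \<in> E. e \<inter> S \<noteq> {}}"

text \<open>Ordered pairs with the inner end first, since \<open>phi\<close> asks for a connection
  to that end; by \<open>inj_on_boundary\<close> no edge is counted twice.\<close>

definition boundary :: "'v set \<Rightarrow> ('v \<times> 'v) set" where
  "boundary S = {(a, b). a \<in> S \<and> b \<notin> S \<and> {a, b} \<in> E}"

definition phi :: "real \<Rightarrow> 'v \<Rightarrow> 'v set \<Rightarrow> real" where
  "phi p x S = (\<Sum>(a, b)\<in>boundary S.
     p * bexp (\<lambda>_. p) (inner S) (\<lambda>\<omega>. of_bool ((x, a) \<in> (link (\<lambda>e. e) \<omega>)\<^sup>*)))"

lemma finite_touching: "finite S \<Longrightarrow> finite (touching S)"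
proof -
  assume "finite S"
  moreover have "touching S \<subseteq> (\<Union>x\<in>S. {e \<in> E. x \<in> e})"
    by (auto simp: touching_def)
  ultimately show ?thesis
    using locally_finite by (meson finite_UN_I finite_subset)
qed

lemma inner_subset_touching: "inner S \<subseteq> touching S"
  using edge_ends by (fastforce simp: inner_def touching_def)

lemma finite_inner: "finite S \<Longrightarrow> finite (inner S)"
  using finite_touching inner_subset_touching finite_subset by blast

lemma inj_on_boundary: "inj_on (\<lambda>(a, b). {a, b}) (boundary S)"
  by (auto simp: inj_on_def boundary_def doubleton_eq_iff)

lemma finite_boundary: "finite S \<Longrightarrow> finite (boundary S)"
proof -
  assume "finite S"
  moreover have "(\<lambda>(a, b). {a, b}) ` boundary S \<subseteq> touching S"
    by (auto simp: boundary_def touching_def)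
  ultimately show ?thesis
    using finite_touching inj_on_boundary finite_subset finite_imageD by metis
qed

section \<open>Pivotal edges and the differential inequality for exit probabilities\<close>

definition enclosed :: "'v set \<Rightarrow> 'v set set \<Rightarrow> 'v set" where
  "enclosed \<Lambda> \<omega> = {x. \<not> reach (link (\<lambda>e. e) \<omega>) {x} (- \<Lambda>)}"

lemma enclosed_subset: "enclosed \<Lambda> \<omega> \<subseteq> \<Lambda>"
  by (auto simp: enclosed_def reach_def)

lemma not_enclosed_step:
  "\<lbrakk>(x, y) \<in> link (\<lambda>e. e) \<omega>; y \<notin> enclosed \<Lambda> \<omega>\<rbrakk> \<Longrightarrow> x \<notin> enclosed \<Lambda> \<omega>"
  by (auto simp: enclosed_def reach_def intro: converse_rtrancl_into_rtrancl)

text \<open>An open path that ends outside \<Lambda> never visits the enclosed set, so none of its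
  edges is inside S. The event that the enclosed set equals S is therefore decided by the edges not
  inside S, and the inside of S stays independent of it.\<close>

lemma enclosed_diff_inner:
  assumes "\<omega> \<subseteq> E"
  shows "enclosed \<Lambda> (\<omega> - inner S) = S \<longleftrightarrow> enclosed \<Lambda> \<omega> = S"
proof -
  let ?\<eta> = "\<omega> - inner S"
  have keep: "(x, y) \<in> link (\<lambda>e. e) ?\<eta>" if "(x, y) \<in> link (\<lambda>e. e) \<omega>" "x \<notin> S \<or> y \<notin> S" for x y
    using that by (auto simp: link_def inner_def)
  have sub: "enclosed \<Lambda> \<omega> \<subseteq> enclosed \<Lambda> ?\<eta>"
    using reach_link_mono[OF _ Diff_subset] by (fastforce simp: enclosed_def)
  \<comment> \<open>The path is followed backwards from its end outside \<Lambda>: each vertex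
    treated so far is outside S, so the preceding edge is not inside S and survives in
    \<open>?\<eta>\<close>.\<close>
  have out: "x \<notin> enclosed \<Lambda> ?\<eta>"
    if "(x, y) \<in> (link (\<lambda>e. e) \<omega>)\<^sup>*" "y \<notin> \<Lambda>" and S: "S = enclosed \<Lambda> \<omega> \<or> S = enclosed \<Lambda> ?\<eta>" for x y
    using that(1,2)
  proof (induction rule: converse_rtrancl_induct)
    case base
    thus ?case using enclosed_subset by blast
  next
    case (step x z)
    hence z: "z \<notin> enclosed \<Lambda> ?\<eta>" by blast
    hence "z \<notin> S"
      using S sub by blast
    thus ?case
      using keep[OF step(1)] z not_enclosed_step by blast
  qed
  have "enclosed \<Lambda> ?\<eta> \<subseteq> enclosed \<Lambda> \<omega>" if "S = enclosed \<Lambda> \<omega> \<or> S = enclosed \<Lambda> ?\<eta>"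
    using out that by (auto simp: enclosed_def[of \<Lambda> \<omega>] reach_def)
  thus ?thesis
    using sub by blast
qed

text \<open>The event of no exit is split according to the enclosed set S. Given S, the edges inside
  it are still fresh, and every boundary edge whose inner end is joined to z inside S is pivotal.
  The bound on \<open>phi\<close> makes the expected number of such edges at least one on each part,
  so the derivative of the exit probability \<theta> is at least 1 - \<theta>.\<close>

lemma exit_probability_derivative_ge:
  assumes "finite \<Lambda>" "p \<in> {0..1}"
    and phi: "\<And>S. \<lbrakk>S \<subseteq> \<Lambda>; z \<in> S\<rbrakk> \<Longrightarrow> 1 \<le> phi p z S"
  defines "F \<equiv> touching \<Lambda>"
    and "f \<equiv> \<lambda>\<omega>. of_bool (reach (link (\<lambda>e. e) \<omega>) {z} (- \<Lambda>))"
  shows "1 - bexp (\<lambda>_. p) F f \<le> (\<Sum>e\<in>F. bexp (\<lambda>_. p) (F - {e}) (\<lambda>\<omega>. f (insert e \<omega>) - f \<omega>))"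
proof -
  let ?E = "bexp (\<lambda>_. p)"
  have pr: "range (\<lambda>_::'v set. p) \<subseteq> {0..1}" "0 \<le> p" "p \<le> 1"
    using assms(2) by auto
  have F: "finite F" "F \<subseteq> E"
    using finite_touching assms(1) by (auto simp: F_def touching_def)
  have mono: "f \<omega> \<le> f \<eta>" if "\<omega> \<subseteq> \<eta>" for \<omega> \<eta>
    using reach_link_mono[OF _ that] by (auto simp: f_def)
  \<comment> \<open>The enclosed set detects pivotal edges that are closed; demanding that e be
    closed costs the factor 1 - p, which is at most one.\<close>
  have step1: "?E F (\<lambda>\<omega>. of_bool (e \<notin> \<omega>) * (f (insert e \<omega>) - f \<omega>))
      \<le> ?E (F - {e}) (\<lambda>\<omega>. f (insert e \<omega>) - f \<omega>)" if "e \<in> F" for e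
  proof -
    let ?g = "\<lambda>\<omega>. of_bool (e \<notin> \<omega>) * (f (insert e \<omega>) - f \<omega>)"
    have "?E (insert e (F - {e})) ?g
        = p * ?E (F - {e}) (\<lambda>\<omega>. ?g (insert e \<omega>)) + (1 - p) * ?E (F - {e}) ?g"
      using F by (intro bexp_insert) auto
    also have "\<dots> = (1 - p) * ?E (F - {e}) ?g"
      using F by (simp add: bexp_const)
    also have "?E (F - {e}) ?g = ?E (F - {e}) (\<lambda>\<omega>. f (insert e \<omega>) - f \<omega>)"
      by (intro bexp_cong) auto
    also have "(1 - p) * \<dots> \<le> 1 * \<dots>"
    proof (intro mult_right_mono)
      have "?E (F - {e}) (\<lambda>_. 0) \<le> ?E (F - {e}) (\<lambda>\<omega>. f (insert e \<omega>) - f \<omega>)"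
        using mono[of _ "insert e _"] by (intro bexp_mono pr) auto
      thus "0 \<le> ?E (F - {e}) (\<lambda>\<omega>. f (insert e \<omega>) - f \<omega>)"
        using F by (simp add: bexp_const)
    qed (use pr in auto)
    finally show ?thesis
      using that by (simp add: insert_absorb)
  qed
  let ?h = "\<lambda>S a \<omega>. of_bool (enclosed \<Lambda> \<omega> = S) * of_bool ((z, a) \<in> (link (\<lambda>e. e) (\<omega> \<inter> inner S))\<^sup>*) :: real"
  let ?Z = "{S \<in> Pow \<Lambda>. z \<in> S}"
  have finZ: "finite ?Z"
    using assms(1) by auto
  \<comment> \<open>Only the S equal to the enclosed set contributes. Its boundary edges are closed,
    and opening one whose inner end a is joined to z completes a path through a and b out of
    \<Lambda>.\<close>
  have point: "(\<Sum>S\<in>?Z. \<Sum>(a, b)\<in>boundary S. ?h S a \<omega>)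
      \<le> (\<Sum>e\<in>F. of_bool (e \<notin> \<omega>) * (f (insert e \<omega>) - f \<omega>))" (is "?l \<le> ?r") if \<omega>: "\<omega> \<subseteq> F" for \<omega>
  proof (cases "z \<in> enclosed \<Lambda> \<omega>")
    case False
    hence "?l = 0"
      by (intro sum.neutral ballI) auto
    moreover have "0 \<le> ?r"
      using mono[of \<omega> "insert _ \<omega>"] by (intro sum_nonneg mult_nonneg_nonneg) auto
    ultimately show ?thesis by simp
  next
    case True
    define S where "S = enclosed \<Lambda> \<omega>"
    have S: "S \<in> ?Z"
      using True enclosed_subset by (auto simp: S_def)
    have "?l = (\<Sum>S'\<in>?Z. if S' = S then \<Sum>(a, b)\<in>boundary S. ?h S a \<omega> else 0)"
      by (intro sum.cong) (auto simp: S_def)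
    also have "\<dots> = (\<Sum>(a, b)\<in>boundary S. ?h S a \<omega>)"
      using S finZ by (simp add: sum.delta)
    also have "\<dots> \<le> (\<Sum>(a, b)\<in>boundary S. of_bool ({a, b} \<notin> \<omega>) * (f (insert {a, b} \<omega>) - f \<omega>))"
    proof (intro sum_mono, clarify)
      fix a b assume ab: "(a, b) \<in> boundary S"
      hence mem: "a \<in> S" "b \<notin> S"
        by (auto simp: boundary_def)
      have notin: "{a, b} \<notin> \<omega>"
      proof
        assume "{a, b} \<in> \<omega>"
        hence "(a, b) \<in> link (\<lambda>e. e) \<omega>"
          by (auto simp: link_def)
        thus False
          using not_enclosed_step mem by (auto simp: S_def)
      qed
      have "f \<omega> = 0"
        using True by (auto simp: f_def enclosed_def)
      moreover have "f (insert {a, b} \<omega>) = 1" if za: "(z, a) \<in> (link (\<lambda>e. e) (\<omega> \<inter> inner S))\<^sup>*"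
      proof -
        let ?L = "link (\<lambda>e. e) (insert {a, b} \<omega>)"
        obtain y where y: "y \<notin> \<Lambda>" "(b, y) \<in> (link (\<lambda>e. e) \<omega>)\<^sup>*"
          using mem(2) by (auto simp: S_def enclosed_def reach_def)
        have sub: "link (\<lambda>e. e) (\<omega> \<inter> inner S) \<subseteq> ?L" "link (\<lambda>e. e) \<omega> \<subseteq> ?L"
          by (auto intro!: link_mono)
        have "(z, a) \<in> ?L\<^sup>*" "(b, y) \<in> ?L\<^sup>*"
          using za y rtrancl_mono[OF sub(1)] rtrancl_mono[OF sub(2)] by auto
        moreover have "(a, b) \<in> ?L"
          by (auto simp: link_def)
        ultimately have "(z, y) \<in> ?L\<^sup>*"
          by (meson rtrancl.rtrancl_into_rtrancl rtrancl_trans)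
        thus ?thesis
          using y by (auto simp: f_def reach_def)
      qed
      moreover have "0 \<le> f (insert {a, b} \<omega>)"
        by (simp add: f_def)
      ultimately show "?h S a \<omega> \<le> of_bool ({a, b} \<notin> \<omega>) * (f (insert {a, b} \<omega>) - f \<omega>)"
        using notin by auto
    qed
    also have "\<dots> = (\<Sum>e\<in>(\<lambda>(a, b). {a, b}) ` boundary S. of_bool (e \<notin> \<omega>) * (f (insert e \<omega>) - f \<omega>))"
      by (subst sum.reindex[OF inj_on_boundary]) (auto intro!: sum.cong)
    also have "\<dots> \<le> ?r"
      using S mono[of \<omega> "insert _ \<omega>"]
      by (intro sum_mono2 F(1)) (auto simp: F_def touching_def boundary_def)
    finally show ?thesis .
  qed
  have indep: "?E F (?h S a) = ?E F (\<lambda>\<omega>. of_bool (enclosed \<Lambda> \<omega> = S))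
      * ?E (inner S) (\<lambda>\<omega>. of_bool ((z, a) \<in> (link (\<lambda>e. e) \<omega>)\<^sup>*))" if "S \<subseteq> \<Lambda>" for S a
  proof -
    let ?f = "\<lambda>\<omega>. of_bool (enclosed \<Lambda> \<omega> = S) :: real"
    have "inner S \<subseteq> F"
      using that inner_subset_touching[of S] by (auto simp: F_def touching_def)
    have eq: "?f (\<omega> \<inter> (F - inner S)) = ?f \<omega>" if "\<omega> \<subseteq> F" for \<omega>
    proof -
      have "\<omega> \<inter> (F - inner S) = \<omega> - inner S"
        using that by auto
      thus ?thesis
        using enclosed_diff_inner[of \<omega> \<Lambda> S] that F by auto
    qed
    have "?E F (?h S a) = ?E F (\<lambda>\<omega>. ?f (\<omega> \<inter> (F - inner S))
        * of_bool ((z, a) \<in> (link (\<lambda>e. e) (\<omega> \<inter> inner S))\<^sup>*))"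
      by (intro bexp_cong) (simp only: eq)
    also have "\<dots> = ?E (F - inner S) ?f * ?E (inner S) (\<lambda>\<omega>. of_bool ((z, a) \<in> (link (\<lambda>e. e) \<omega>)\<^sup>*))"
      using F \<open>inner S \<subseteq> F\<close> by (intro bexp_indep[where g = "\<lambda>\<omega>. of_bool ((z, a) \<in> (link (\<lambda>e. e) \<omega>)\<^sup>*)"]) auto
    also have "?E (F - inner S) ?f = ?E F (\<lambda>\<omega>. ?f (\<omega> \<inter> (F - inner S)))"
      using F by (intro bexp_restrict[symmetric]) auto
    also have "\<dots> = ?E F ?f"
      by (intro bexp_cong) (simp only: eq)
    finally show ?thesis .
  qed
  have nonneg: "0 \<le> ?E G (\<lambda>\<omega>. of_bool (P \<omega>))" if "finite G" for G :: "'v set set" and P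
    using bexp_mono[OF pr(1), of G "\<lambda>_. 0" "\<lambda>\<omega>. of_bool (P \<omega>)"] that by (simp add: bexp_const)
  have "1 - ?E F f = ?E F (\<lambda>\<omega>. 1 - f \<omega>)"
    using F by (simp add: bexp_diff bexp_const)
  also have "\<dots> = ?E F (\<lambda>\<omega>. \<Sum>S\<in>?Z. of_bool (enclosed \<Lambda> \<omega> = S))"
  proof (intro bexp_cong)
    fix \<omega>
    have "1 - f \<omega> = of_bool (enclosed \<Lambda> \<omega> \<in> ?Z)"
      using enclosed_subset[of \<Lambda> \<omega>] by (auto simp: f_def enclosed_def)
    also have "\<dots> = (\<Sum>S\<in>?Z. of_bool (enclosed \<Lambda> \<omega> = S))"
      using finZ by (simp add: of_bool_def sum.delta')
    finally show "1 - f \<omega> = (\<Sum>S\<in>?Z. of_bool (enclosed \<Lambda> \<omega> = S))" .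
  qed
  also have "\<dots> = (\<Sum>S\<in>?Z. ?E F (\<lambda>\<omega>. of_bool (enclosed \<Lambda> \<omega> = S)))"
    by (rule bexp_sum)
  also have "\<dots> \<le> (\<Sum>S\<in>?Z. ?E F (\<lambda>\<omega>. of_bool (enclosed \<Lambda> \<omega> = S)) * phi p z S)"
  proof (intro sum_mono)
    fix S assume "S \<in> ?Z"
    hence "?E F (\<lambda>\<omega>. of_bool (enclosed \<Lambda> \<omega> = S)) * 1
        \<le> ?E F (\<lambda>\<omega>. of_bool (enclosed \<Lambda> \<omega> = S)) * phi p z S"
      using F by (intro mult_left_mono phi nonneg) auto
    thus "?E F (\<lambda>\<omega>. of_bool (enclosed \<Lambda> \<omega> = S))
        \<le> ?E F (\<lambda>\<omega>. of_bool (enclosed \<Lambda> \<omega> = S)) * phi p z S"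
      by simp
  qed
  also have "\<dots> \<le> (\<Sum>S\<in>?Z. \<Sum>(a, b)\<in>boundary S. ?E F (?h S a))"
  proof (intro sum_mono)
    fix S assume S: "S \<in> ?Z"
    have finS: "finite S"
      using S assms(1) finite_subset by auto
    \<comment> \<open>The right-hand side counts boundary edges without the factor p of
      \<open>phi\<close>, which is at most one.\<close>
    have "phi p z S \<le> (\<Sum>(a, b)\<in>boundary S. ?E (inner S) (\<lambda>\<omega>. of_bool ((z, a) \<in> (link (\<lambda>e. e) \<omega>)\<^sup>*)))"
      unfolding phi_def using pr nonneg finite_inner[OF finS]
      by (intro sum_mono) (auto intro!: mult_left_le_one_le)
    hence "?E F (\<lambda>\<omega>. of_bool (enclosed \<Lambda> \<omega> = S)) * phi p z S
        \<le> ?E F (\<lambda>\<omega>. of_bool (enclosed \<Lambda> \<omega> = S))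
          * (\<Sum>(a, b)\<in>boundary S. ?E (inner S) (\<lambda>\<omega>. of_bool ((z, a) \<in> (link (\<lambda>e. e) \<omega>)\<^sup>*)))"
      using F by (intro mult_left_mono nonneg) auto
    also have "\<dots> = (\<Sum>(a, b)\<in>boundary S. ?E F (?h S a))"
      using S by (simp add: indep sum_distrib_left case_prod_unfold)
    finally show "?E F (\<lambda>\<omega>. of_bool (enclosed \<Lambda> \<omega> = S)) * phi p z S
        \<le> (\<Sum>(a, b)\<in>boundary S. ?E F (?h S a))" .
  qed
  also have "\<dots> = ?E F (\<lambda>\<omega>. \<Sum>S\<in>?Z. \<Sum>(a, b)\<in>boundary S. ?h S a \<omega>)"
    by (simp add: bexp_sum case_prod_unfold)
  also have "\<dots> \<le> ?E F (\<lambda>\<omega>. \<Sum>e\<in>F. of_bool (e \<notin> \<omega>) * (f (insert e \<omega>) - f \<omega>))"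
    by (intro bexp_mono pr point)
  also have "\<dots> = (\<Sum>e\<in>F. ?E F (\<lambda>\<omega>. of_bool (e \<notin> \<omega>) * (f (insert e \<omega>) - f \<omega>)))"
    by (rule bexp_sum)
  also have "\<dots> \<le> (\<Sum>e\<in>F. ?E (F - {e}) (\<lambda>\<omega>. f (insert e \<omega>) - f \<omega>))"
    by (intro sum_mono step1)
  finally show ?thesis .
qed

text \<open>By the differential inequality (1 - \<theta>(r)) e^r is nonincreasing on [p0, p]. The
  bound is the same for all \<Lambda>, so it survives the limit that leads to infinite
  clusters.\<close>

lemma exit_probability_ge:
  assumes "finite \<Lambda>" "0 \<le> p0" "p0 \<le> p" "p \<le> 1"
    and phi: "\<And>r S. \<lbrakk>p0 \<le> r; r \<le> p; finite S; z \<in> S\<rbrakk> \<Longrightarrow> 1 \<le> phi r z S"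
  shows "1 - exp (p0 - p) \<le>
    bexp (\<lambda>_. p) (touching \<Lambda>) (\<lambda>\<omega>. of_bool (reach (link (\<lambda>e. e) \<omega>) {z} (- \<Lambda>)))"
proof -
  let ?f = "\<lambda>\<omega>. of_bool (reach (link (\<lambda>e. e) \<omega>) {z} (- \<Lambda>)) :: real"
  let ?th = "\<lambda>r. bexp (\<lambda>_. r) (touching \<Lambda>) ?f"
  let ?D = "\<lambda>r. \<Sum>e\<in>touching \<Lambda>. bexp (\<lambda>_. r) (touching \<Lambda> - {e}) (\<lambda>\<omega>. ?f (insert e \<omega>) - ?f \<omega>)"
  have "(1 - ?th p) * exp p \<le> (1 - ?th p0) * exp p0"
  proof (rule DERIV_nonpos_imp_nonincreasing[OF assms(3)])
    fix r assume r: "p0 \<le> r" "r \<le> p"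
    have "((\<lambda>r. (1 - ?th r) * exp r) has_real_derivative ((1 - ?th r) - ?D r) * exp r) (at r)"
      by (rule derivative_eq_intros bexp_has_real_derivative finite_touching assms refl
          | simp add: algebra_simps)+
    moreover have "1 - ?th r \<le> ?D r"
      using assms r finite_subset[OF _ assms(1)] by (intro exit_probability_derivative_ge) auto
    hence "((1 - ?th r) - ?D r) * exp r \<le> 0"
      by (intro mult_nonpos_nonneg) auto
    ultimately show "\<exists>y. ((\<lambda>r. (1 - ?th r) * exp r) has_real_derivative y) (at r) \<and> y \<le> 0"
      by blast
  qed
  also have "\<dots> \<le> 1 * exp p0"
  proof (intro mult_right_mono)
    have "bexp (\<lambda>_. p0) (touching \<Lambda>) (\<lambda>_. 0) \<le> ?th p0"
      using assms by (intro bexp_mono) auto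
    thus "1 - ?th p0 \<le> 1"
      using assms finite_touching by (simp add: bexp_const)
  qed auto
  finally have "1 - ?th p \<le> exp p0 / exp p"
    by (simp add: field_simps)
  thus ?thesis
    by (simp add: exp_diff)
qed

section \<open>Exponential decay when the functional is below one\<close>

definition cluster :: "'v set \<Rightarrow> 'v \<Rightarrow> 'v set set \<Rightarrow> 'v set" where
  "cluster S x \<omega> = {a. (x, a) \<in> (link (\<lambda>e. e) (\<omega> \<inter> inner S))\<^sup>*}"

lemma cluster_subset: "x \<in> S \<Longrightarrow> cluster S x \<omega> \<subseteq> S"
proof
  fix a assume "x \<in> S" "a \<in> cluster S x \<omega>"
  hence "(x, a) \<in> (link (\<lambda>e. e) (\<omega> \<inter> inner S))\<^sup>*"
    by (simp add: cluster_def)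
  thus "a \<in> S"
    by (induction rule: rtrancl_induct) (use \<open>x \<in> S\<close> in \<open>auto simp: link_def inner_def\<close>)
qed

text \<open>Paths that build the cluster stay in C, so the edges inside S that meet C decide whether
  the cluster equals C. Edges avoiding C are independent of this event.\<close>

lemma cluster_restrict:
  assumes "\<omega> \<subseteq> F"
  shows "cluster S x (\<omega> \<inter> {e \<in> F. e \<subseteq> S \<and> e \<inter> C \<noteq> {}}) = C \<longleftrightarrow> cluster S x \<omega> = C"
proof -
  let ?\<eta> = "\<omega> \<inter> {e \<in> F. e \<subseteq> S \<and> e \<inter> C \<noteq> {}}"
  have sub: "cluster S x ?\<eta> \<subseteq> cluster S x \<omega>"
  proof -
    have "link (\<lambda>e. e) (?\<eta> \<inter> inner S) \<subseteq> link (\<lambda>e. e) (\<omega> \<inter> inner S)"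
      by (intro link_mono) auto
    from rtrancl_mono[OF this] show ?thesis
      by (auto simp: cluster_def)
  qed
  have "cluster S x \<omega> \<subseteq> cluster S x ?\<eta>" if C: "C = cluster S x \<omega> \<or> C = cluster S x ?\<eta>"
  proof
    fix a assume "a \<in> cluster S x \<omega>"
    hence "(x, a) \<in> (link (\<lambda>e. e) (\<omega> \<inter> inner S))\<^sup>*"
      by (simp add: cluster_def)
    thus "a \<in> cluster S x ?\<eta>"
    proof (induction rule: rtrancl_induct)
      case base
      thus ?case by (simp add: cluster_def)
    next
      case (step a b)
      hence "a \<in> C"
        using C sub by blast
      with step(2) assms have "(a, b) \<in> link (\<lambda>e. e) (?\<eta> \<inter> inner S)"
        by (auto simp: link_def inner_def)
      thus ?case
        using step.IH unfolding cluster_def by (auto intro: rtrancl.rtrancl_into_rtrancl)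
    qed
  qed
  thus ?thesis
    using sub by blast
qed

text \<open>A path leaving \<open>S\<close> is cut at its last visit to the cluster of its starting point within \<open>S\<close>.\<close>

lemma last_exit:
  assumes "reach (link (\<lambda>e. e) \<omega>) {x} T" "\<omega> \<subseteq> E" "x \<in> S" "S \<inter> T = {}"
  shows "\<exists>(a, b)\<in>boundary S. {a, b} \<in> \<omega> \<and> a \<in> cluster S x \<omega> \<and>
    reach (link (\<lambda>e. e) {e \<in> \<omega>. e \<inter> cluster S x \<omega> = {}}) {b} T"
proof -
  define C where "C = cluster S x \<omega>"
  define R where "R = link (\<lambda>e. e) {e \<in> \<omega>. e \<inter> C = {}}"
  have CS: "C \<subseteq> S"
    using cluster_subset assms by (simp add: C_def)
  obtain y where y: "y \<in> T" "(x, y) \<in> (link (\<lambda>e. e) \<omega>)\<^sup>*"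
    using assms(1) by (auto simp: reach_def)
  \<comment> \<open>From a vertex of C no step of R is possible, and y itself is not in C, since C
    lies in S and S misses T.\<close>
  have isolated: "\<not> (v, y) \<in> R\<^sup>*" if "v \<in> C" for v
  proof
    assume "(v, y) \<in> R\<^sup>*"
    thus False
    proof (cases rule: converse_rtranclE)
      case base
      thus ?thesis using that CS y assms by auto
    next
      case (step w)
      thus ?thesis using that by (auto simp: R_def link_def)
    qed
  qed
  have "(x, y) \<in> R\<^sup>* \<or> (\<exists>(a, b)\<in>boundary S. {a, b} \<in> \<omega> \<and> a \<in> C \<and> (b, y) \<in> R\<^sup>*)"
    using y(2)
  proof (induction rule: converse_rtrancl_induct)
    case base
    thus ?case by simp
  next
    case (step v w)
    have vw: "{v, w} \<in> \<omega>"
      using step(1) by (auto simp: link_def)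
    show ?case
    proof (cases "(w, y) \<in> R\<^sup>*")
      case True
      hence w: "w \<notin> C"
        using isolated by blast
      show ?thesis
      proof (cases "v \<in> C")
        case False
        hence "(v, w) \<in> R"
          using w vw by (auto simp: R_def link_def)
        thus ?thesis
          using True by (blast intro: converse_rtrancl_into_rtrancl)
      next
        case vC: True
        have "w \<notin> S"
        proof
          assume "w \<in> S"
          hence "(v, w) \<in> link (\<lambda>e. e) (\<omega> \<inter> inner S)"
            using vw vC CS assms by (auto simp: link_def inner_def)
          hence "w \<in> C"
            using vC unfolding C_def cluster_def by (auto intro: rtrancl.rtrancl_into_rtrancl)
          thus False
            using w by simp
        qed
        hence "(v, w) \<in> boundary S"
          using vC CS vw assms by (auto simp: boundary_def)
        thus ?thesis
          using True vC vw by blast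
      qed
    qed (use step in auto)
  qed
  moreover have "x \<in> C"
    by (simp add: C_def cluster_def)
  ultimately show ?thesis
    using isolated y(1) unfolding reach_def R_def[symmetric] C_def[symmetric] by blast
qed

text \<open>Condition on the cluster C of x in \<open>S x\<close>. A path to T leaves C for the last
  time through a boundary edge and then avoids C, so it continues on fresh edges. One exit costs the
  factor \<open>phi p x (S x)\<close> \<le> c and raises the height h by at most L; a height
  difference of k L thus forces k such factors.\<close>

lemma exponential_decay:
  fixes h :: "'v \<Rightarrow> int" and L :: nat
  assumes p: "p \<in> {0..1}" and c: "0 \<le> c"
    and S: "\<And>x. x \<in> V \<Longrightarrow> finite (S x) \<and> x \<in> S x \<and> phi p x (S x) \<le> c \<and> (\<forall>y\<in>S x. h y < h x + int L)"
    and bd: "\<And>x a b. \<lbrakk>x \<in> V; (a, b) \<in> boundary (S x)\<rbrakk> \<Longrightarrow> b \<in> V \<and> h b \<le> h x + int L"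
    and "finite F" "F \<subseteq> E" "x \<in> V" "\<And>y. y \<in> T \<Longrightarrow> h x + int k * int L \<le> h y"
  shows "bexp (\<lambda>_. p) F (\<lambda>\<omega>. of_bool (reach (link (\<lambda>e. e) \<omega>) {x} T)) \<le> c ^ k"
  using assms(5-)
proof (induction k arbitrary: F x)
  case 0
  have "bexp (\<lambda>_. p) F (\<lambda>\<omega>. of_bool (reach (link (\<lambda>e. e) \<omega>) {x} T)) \<le> bexp (\<lambda>_. p) F (\<lambda>_. 1)"
    using p by (intro bexp_mono) auto
  thus ?case
    unfolding power_0 bexp_const[OF 0(1)] .
next
  case (Suc k)
  let ?E = "bexp (\<lambda>_. p)"
  have pr: "range (\<lambda>_::'v set. p) \<subseteq> {0..1}" "0 \<le> p"
    using p by auto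
  have nonneg: "0 \<le> ?E G (\<lambda>\<omega>. of_bool (P \<omega>))" if "finite G" for G :: "'v set set" and P
    using bexp_mono[OF pr(1), of G "\<lambda>_. 0" "\<lambda>\<omega>. of_bool (P \<omega>)"] that by (simp add: bexp_const)
  let ?S = "S x" and ?cl = "cluster (S x) x"
  have Sx: "finite ?S" "x \<in> ?S" "phi p x ?S \<le> c"
    using S Suc.prems by auto
  have "h x + int L \<le> h y" if "y \<in> T" for y
  proof -
    have "0 \<le> int k * int L" "int (Suc k) * int L = int k * int L + int L"
      by (simp_all add: algebra_simps)
    thus ?thesis
      using Suc.prems(4)[OF that] by linarith
  qed
  hence disj: "?S \<inter> T = {}"
    using S[OF Suc.prems(3)] by fastforce
  let ?B = "{ab \<in> boundary ?S. {fst ab, snd ab} \<in> F}"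
  have finB: "finite ?B"
    using finite_boundary[OF Sx(1)] by simp
  let ?h = "\<lambda>C a b \<omega>. of_bool (?cl \<omega> = C) * (of_bool ({a, b} \<in> \<omega>)
      * of_bool (reach (link (\<lambda>e. e) {e \<in> \<omega>. e \<inter> C = {}}) {b} T)) :: real"
  have point: "of_bool (reach (link (\<lambda>e. e) \<omega>) {x} T)
      \<le> (\<Sum>(a, b)\<in>?B. \<Sum>C\<in>Pow ?S. of_bool (a \<in> C) * ?h C a b \<omega>)" (is "_ \<le> ?r") if \<omega>: "\<omega> \<subseteq> F" for \<omega>
  proof (cases "reach (link (\<lambda>e. e) \<omega>) {x} T")
    case True
    obtain a b where ab: "(a, b) \<in> boundary ?S" "{a, b} \<in> \<omega>" "a \<in> ?cl \<omega>"
      "reach (link (\<lambda>e. e) {e \<in> \<omega>. e \<inter> ?cl \<omega> = {}}) {b} T"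
      using last_exit[OF True _ Sx(2) disj] \<omega> Suc.prems by blast
    have "1 = of_bool (a \<in> ?cl \<omega>) * ?h (?cl \<omega>) a b \<omega>"
      using ab by simp
    also have "\<dots> \<le> (\<Sum>C\<in>Pow ?S. of_bool (a \<in> C) * ?h C a b \<omega>)"
      using Sx cluster_subset[of x ?S \<omega>]
      by (intro member_le_sum[of _ _ "\<lambda>C. of_bool (a \<in> C) * ?h C a b \<omega>"]) auto
    also have "\<dots> = (case (a, b) of (a, b) \<Rightarrow> \<Sum>C\<in>Pow ?S. of_bool (a \<in> C) * ?h C a b \<omega>)"
      by simp
    also have "\<dots> \<le> ?r"
      using ab \<omega> finB by (intro member_le_sum) (auto intro!: sum_nonneg)
    finally show ?thesis
      using True by simp
  qed (auto intro!: sum_nonneg)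
  have summand: "?E F (\<lambda>\<omega>. of_bool (a \<in> C) * ?h C a b \<omega>)
      \<le> p * c ^ k * ?E F (\<lambda>\<omega>. of_bool (a \<in> C \<and> ?cl \<omega> = C))"
    if ab: "(a, b) \<in> ?B" and C: "C \<subseteq> ?S" for a b C
  proof (cases "a \<in> C")
    case False
    thus ?thesis using Suc.prems by (simp add: bexp_const)
  next
    case True
    have b: "b \<notin> ?S" "{a, b} \<in> F"
      using ab by (auto simp: boundary_def)
    \<comment> \<open>A1 decides the cluster, the edge {a, b} is crossed, and the rest of the path
      uses A3. These three sets are disjoint, whence a product of three probabilities.\<close>
    define A1 where "A1 = {e \<in> F. e \<subseteq> ?S \<and> e \<inter> C \<noteq> {}}"
    define A3 where "A3 = {e \<in> F. e \<inter> C = {}}"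
    have A: "A1 \<subseteq> F" "A3 \<subseteq> F" "A1 \<inter> (insert {a, b} A3) = {}" "{{a, b}} \<inter> A3 = {}"
      using b True by (auto simp: A1_def A3_def)
    let ?f = "\<lambda>\<omega>. of_bool (?cl \<omega> = C) :: real"
    let ?r = "\<lambda>\<omega>. of_bool (reach (link (\<lambda>e. e) \<omega>) {b} T) :: real"
    let ?g = "\<lambda>\<omega>. of_bool ({a, b} \<in> \<omega> \<inter> {{a, b}}) * ?r (\<omega> \<inter> A3)"
    have clu: "?f (\<omega> \<inter> A1) = ?f \<omega>" if "\<omega> \<subseteq> F" for \<omega>
      using cluster_restrict[OF that] by (auto simp: A1_def)
    have "?E F (?h C a b) = ?E F (\<lambda>\<omega>. ?f (\<omega> \<inter> A1) * ?g (\<omega> \<inter> insert {a, b} A3))"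
    proof (intro bexp_cong)
      fix \<omega> assume \<omega>: "\<omega> \<subseteq> F"
      have "{e \<in> \<omega>. e \<inter> C = {}} = \<omega> \<inter> insert {a, b} A3 \<inter> A3"
        using \<omega> by (auto simp: A3_def)
      thus "?h C a b \<omega> = ?f (\<omega> \<inter> A1) * ?g (\<omega> \<inter> insert {a, b} A3)"
        using clu[OF \<omega>] by simp
    qed
    also have "\<dots> = ?E A1 ?f * ?E (insert {a, b} A3) ?g"
      using A b Suc.prems by (intro bexp_indep) auto
    also have "?E (insert {a, b} A3) ?g = ?E {{a, b}} (\<lambda>\<omega>. of_bool ({a, b} \<in> \<omega>)) * ?E A3 ?r"
      using A Suc.prems finite_subset[of A3 F]
      by (intro bexp_indep[of "insert {a, b} A3" "{{a, b}}" A3 "\<lambda>_. p" "\<lambda>\<omega>. of_bool ({a, b} \<in> \<omega>)"]) auto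
    also have "?E {{a, b}} (\<lambda>\<omega>. of_bool ({a, b} \<in> \<omega>)) = p"
      by (simp add: bexp_insert)
    also have "?E A1 ?f = ?E F (\<lambda>\<omega>. ?f (\<omega> \<inter> A1))"
      using A Suc.prems by (intro bexp_restrict[symmetric]) auto
    also have "\<dots> = ?E F ?f"
      by (intro bexp_cong clu)
    also have "?E F ?f * (p * ?E A3 ?r) \<le> ?E F ?f * (p * c ^ k)"
    proof (intro mult_left_mono pr nonneg)
      have hb: "b \<in> V" "h b \<le> h x + int L"
        using bd[OF Suc.prems(3), of a b] ab by auto
      show "?E A3 ?r \<le> c ^ k"
      proof (rule Suc.IH)
        show "finite A3" "A3 \<subseteq> E"
          using A Suc.prems finite_subset[of A3 F] by auto
        show "h b + int k * int L \<le> h y" if "y \<in> T" for y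
          using hb Suc.prems(4)[OF that] by (simp add: algebra_simps)
      qed (fact hb)
    qed (use Suc.prems in auto)
    finally show ?thesis
      using True by (simp add: mult_ac)
  qed
  have "?E F (\<lambda>\<omega>. of_bool (reach (link (\<lambda>e. e) \<omega>) {x} T))
      \<le> ?E F (\<lambda>\<omega>. \<Sum>(a, b)\<in>?B. \<Sum>C\<in>Pow ?S. of_bool (a \<in> C) * ?h C a b \<omega>)"
    by (intro bexp_mono pr point)
  also have "\<dots> = (\<Sum>(a, b)\<in>?B. \<Sum>C\<in>Pow ?S. ?E F (\<lambda>\<omega>. of_bool (a \<in> C) * ?h C a b \<omega>))"
    by (simp only: bexp_sum case_prod_unfold)
  also have "\<dots> \<le> (\<Sum>(a, b)\<in>?B. \<Sum>C\<in>Pow ?S. p * c ^ k * ?E F (\<lambda>\<omega>. of_bool (a \<in> C \<and> ?cl \<omega> = C)))"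
  proof (rule sum_mono, clarify, rule sum_mono)
    fix a b C assume "(a, b) \<in> boundary ?S" "{fst (a, b), snd (a, b)} \<in> F" "C \<in> Pow ?S"
    thus "?E F (\<lambda>\<omega>. of_bool (a \<in> C) * ?h C a b \<omega>)
        \<le> p * c ^ k * ?E F (\<lambda>\<omega>. of_bool (a \<in> C \<and> ?cl \<omega> = C))"
      by (intro summand) auto
  qed
  \<comment> \<open>Summing over the possible clusters C recovers the event that a lies in the
    cluster.\<close>
  also have "\<dots> = (\<Sum>(a, b)\<in>?B. p * c ^ k * ?E F (\<lambda>\<omega>. of_bool (a \<in> ?cl \<omega>)))"
  proof (intro sum.cong refl, clarify)
    fix a b
    have "(\<Sum>C\<in>Pow ?S. of_bool (a \<in> C \<and> ?cl \<omega> = C)) = (of_bool (a \<in> ?cl \<omega>) :: real)" for \<omega>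
    proof -
      have "(\<Sum>C\<in>Pow ?S. of_bool (a \<in> C \<and> ?cl \<omega> = C))
          = (\<Sum>C\<in>Pow ?S. if C = ?cl \<omega> then of_bool (a \<in> ?cl \<omega>) else (0 :: real))"
        by (intro sum.cong) auto
      thus ?thesis
        using Sx cluster_subset[of x ?S \<omega>] by (simp add: sum.delta)
    qed
    thus "(\<Sum>C\<in>Pow ?S. p * c ^ k * ?E F (\<lambda>\<omega>. of_bool (a \<in> C \<and> ?cl \<omega> = C)))
        = p * c ^ k * ?E F (\<lambda>\<omega>. of_bool (a \<in> ?cl \<omega>))"
      by (simp only: sum_distrib_left[symmetric] bexp_sum[symmetric])
  qed
  also have "\<dots> \<le> (\<Sum>(a, b)\<in>?B. c ^ k * (p * ?E (inner ?S) (\<lambda>\<omega>. of_bool ((x, a) \<in> (link (\<lambda>e. e) \<omega>)\<^sup>*))))"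
  proof (intro sum_mono, clarify)
    fix a b
    let ?m = "\<lambda>\<omega>. of_bool ((x, a) \<in> (link (\<lambda>e. e) \<omega>)\<^sup>*) :: real"
    have "?E F (\<lambda>\<omega>. of_bool (a \<in> ?cl \<omega>)) = ?E F (\<lambda>\<omega>. ?m (\<omega> \<inter> (F \<inter> inner ?S)))"
      by (intro bexp_cong) (auto simp: cluster_def Int_absorb2 simp flip: Int_assoc)
    also have "\<dots> = ?E (F \<inter> inner ?S) ?m"
      using Suc.prems by (intro bexp_restrict) auto
    \<comment> \<open>F may lack edges inside \<open>?S\<close>; adding them can only make the
      connection more likely.\<close>
    also have "\<dots> \<le> ?E (inner ?S) ?m"
    proof (intro bexp_mono_set pr finite_inner Sx)
      show "mono ?m"
      proof (rule monoI)
        fix \<omega> \<eta> :: "'v set set" assume "\<omega> \<subseteq> \<eta>"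
        thus "?m \<omega> \<le> ?m \<eta>"
          using rtrancl_mono[OF link_mono[of \<omega> \<eta> "\<lambda>e. e"]] by auto
      qed
    qed auto
    finally show "p * c ^ k * ?E F (\<lambda>\<omega>. of_bool (a \<in> ?cl \<omega>)) \<le> c ^ k * (p * ?E (inner ?S) ?m)"
      using pr c by (simp add: mult_left_mono mult_ac)
  qed
  also have "\<dots> \<le> (\<Sum>(a, b)\<in>boundary ?S. c ^ k * (p * ?E (inner ?S) (\<lambda>\<omega>. of_bool ((x, a) \<in> (link (\<lambda>e. e) \<omega>)\<^sup>*))))"
    using pr c nonneg finite_inner[OF Sx(1)]
    by (intro sum_mono2 finite_boundary Sx(1)) auto
  also have "\<dots> = c ^ k * phi p x ?S"
    by (simp add: phi_def sum_distrib_left case_prod_unfold)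
  also have "\<dots> \<le> c ^ k * c"
    using Sx c by (intro mult_left_mono) auto
  finally show ?case
    by (simp add: mult_ac)
qed

section \<open>Positivity and symmetry of the functional, locality of exits\<close>

lemma phi_nonneg:
  assumes "p \<in> {0..1}" "finite S"
  shows "0 \<le> phi p x S"
proof -
  have "0 \<le> bexp (\<lambda>_. p) (inner S) (\<lambda>\<omega>. of_bool (P \<omega>))" for P
    using bexp_mono[of "\<lambda>_. p" "inner S" "\<lambda>_. 0" "\<lambda>\<omega>. of_bool (P \<omega>)"] assms finite_inner
    by (auto simp: bexp_const)
  thus ?thesis
    unfolding phi_def using assms by (intro sum_nonneg) auto
qed

text \<open>An automorphism carries the boundary and inner edges of S to those of its image, and
  paths are pulled back along it. Applied to translations, it lets one finite set around the origin
  serve every starting vertex.\<close>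

lemma phi_image_le:
  assumes f: "bij f" "\<And>a b. {f a, f b} \<in> E \<longleftrightarrow> {a, b} \<in> E" and p: "p \<in> {0..1}" and "finite S"
  shows "phi p (f z) (f ` S) \<le> phi p z S"
proof -
  have inj: "inj f" and surj: "surj f"
    using f(1) by (auto simp: bij_def)
  have edge: "f ` e \<in> E \<longleftrightarrow> e \<in> E" if "e = {a, b}" for e a b
    using that f(2) by simp
  have bnd: "boundary (f ` S) = map_prod f f ` boundary S"
  proof (intro equalityI subrelI)
    fix a b assume ab: "(a, b) \<in> boundary (f ` S)"
    obtain b' where "b = f b'"
      using surj by (auto simp: surj_def)
    thus "(a, b) \<in> map_prod f f ` boundary S"
      using ab f(2) by (force simp: boundary_def)
  next
    fix a b assume "(a, b) \<in> map_prod f f ` boundary S"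
    thus "(a, b) \<in> boundary (f ` S)"
      using f(2) inj by (auto simp: boundary_def dest: injD)
  qed
  have inn: "inner (f ` S) = (`) f ` inner S"
  proof (intro equalityI subsetI)
    fix e assume e: "e \<in> inner (f ` S)"
    then obtain e' where e': "e' \<subseteq> S" "e = f ` e'"
      by (auto simp: inner_def subset_image_iff)
    obtain x y where xy: "e = {x, y}"
      using e edge_ends unfolding inner_def by blast
    obtain x' y' where "x = f x'" "y = f y'"
      using surj by (meson surj_def)
    hence "f ` e' = f ` {x', y'}"
      using e' xy by simp
    hence "e' = {x', y'}"
      using inj by (simp only: inj_image_eq_iff)
    hence "e' \<in> E"
      using e e'(2) edge by (simp add: inner_def)
    thus "e \<in> (`) f ` inner S"
      using e' by (auto simp: inner_def)
  next
    fix e assume "e \<in> (`) f ` inner S"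
    then obtain e' where e': "e' \<in> E" "e' \<subseteq> S" "e = f ` e'"
      by (auto simp: inner_def)
    obtain x y where "e' = {x, y}"
      using e'(1) edge_ends by blast
    thus "e \<in> inner (f ` S)"
      using e' edge by (auto simp: inner_def)
  qed
  have pull: "\<exists>a. v = f a \<and> (z, a) \<in> (link (\<lambda>e. e) \<omega>)\<^sup>*"
    if "(f z, v) \<in> (link (\<lambda>e. e) ((`) f ` \<omega>))\<^sup>*" for v \<omega>
    using that
  proof (induction rule: rtrancl_induct)
    case (step v w)
    then obtain a where a: "v = f a" "(z, a) \<in> (link (\<lambda>e. e) \<omega>)\<^sup>*"
      by blast
    obtain e where e: "e \<in> \<omega>" "f ` e = {v, w}"
      using step(2) by (auto simp: link_def)
    obtain b where b: "w = f b"
      using surj by (meson surj_def)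
    have "f ` e = f ` {a, b}"
      using e a b by simp
    hence "e = {a, b}"
      using inj by (simp only: inj_image_eq_iff)
    hence "(a, b) \<in> link (\<lambda>e. e) \<omega>"
      using e by (auto simp: link_def)
    thus ?case
      using a b by (auto intro: rtrancl.rtrancl_into_rtrancl)
  qed auto
  have *: "bexp (\<lambda>_. p) (inner (f ` S)) (\<lambda>\<omega>. of_bool ((f z, f a) \<in> (link (\<lambda>e. e) \<omega>)\<^sup>*))
      \<le> bexp (\<lambda>_. p) (inner S) (\<lambda>\<omega>. of_bool ((z, a) \<in> (link (\<lambda>e. e) \<omega>)\<^sup>*))" for a
  proof -
    have "inj_on ((`) f) (inner S)"
      using inj by (auto simp: inj_on_def inj_image_eq_iff)
    hence "bexp (\<lambda>_. p) (inner (f ` S)) (\<lambda>\<omega>. of_bool ((f z, f a) \<in> (link (\<lambda>e. e) \<omega>)\<^sup>*))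
        = bexp (\<lambda>_. p) (inner S) (\<lambda>\<omega>. of_bool ((f z, f a) \<in> (link (\<lambda>e. e) ((`) f ` \<omega>))\<^sup>*))"
      unfolding inn by (intro bexp_image) auto
    also have "\<dots> \<le> bexp (\<lambda>_. p) (inner S) (\<lambda>\<omega>. of_bool ((z, a) \<in> (link (\<lambda>e. e) \<omega>)\<^sup>*))"
    proof (intro bexp_mono)
      fix \<omega>
      have "(z, a) \<in> (link (\<lambda>e. e) \<omega>)\<^sup>*" if "(f z, f a) \<in> (link (\<lambda>e. e) ((`) f ` \<omega>))\<^sup>*"
        using pull[OF that] inj by (auto dest: injD)
      thus "of_bool ((f z, f a) \<in> (link (\<lambda>e. e) ((`) f ` \<omega>))\<^sup>*)
          \<le> (of_bool ((z, a) \<in> (link (\<lambda>e. e) \<omega>)\<^sup>*) :: real)"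
        by auto
    qed (use p in auto)
    finally show ?thesis .
  qed
  have "inj_on (map_prod f f) (boundary S)"
    using inj by (auto simp: inj_on_def dest: injD)
  hence "phi p (f z) (f ` S) = (\<Sum>(a, b)\<in>boundary S.
      p * bexp (\<lambda>_. p) (inner (f ` S)) (\<lambda>\<omega>. of_bool ((f z, f a) \<in> (link (\<lambda>e. e) \<omega>)\<^sup>*)))"
    unfolding phi_def bnd by (subst sum.reindex) (auto intro!: sum.cong)
  also have "\<dots> \<le> phi p z S"
    unfolding phi_def using p * by (intro sum_mono) (auto intro!: mult_left_mono)
  finally show ?thesis .
qed

text \<open>Up to its first vertex outside \<Lambda> a path uses only edges that touch \<Lambda>.
  For finite \<Lambda> the exit event thus depends on finitely many edges.\<close>

lemma reach_touching_iff:
  assumes "\<omega> \<subseteq> E"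
  shows "reach (link (\<lambda>e. e) (\<omega> \<inter> touching \<Lambda>)) {z} (- \<Lambda>) \<longleftrightarrow> reach (link (\<lambda>e. e) \<omega>) {z} (- \<Lambda>)"
proof
  assume "reach (link (\<lambda>e. e) \<omega>) {z} (- \<Lambda>)"
  then obtain y where "y \<notin> \<Lambda>" "(z, y) \<in> (link (\<lambda>e. e) \<omega>)\<^sup>*"
    by (auto simp: reach_def)
  from this(2) show "reach (link (\<lambda>e. e) (\<omega> \<inter> touching \<Lambda>)) {z} (- \<Lambda>)"
  proof (induction rule: converse_rtrancl_induct)
    case base
    thus ?case
      using \<open>y \<notin> \<Lambda>\<close> by (auto simp: reach_def)
  next
    case (step v w)
    show ?case
    proof (cases "v \<in> \<Lambda>")
      case False
      thus ?thesis by (auto simp: reach_def)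
    next
      case True
      hence "(v, w) \<in> link (\<lambda>e. e) (\<omega> \<inter> touching \<Lambda>)"
        using step(1) assms by (auto simp: link_def touching_def)
      thus ?thesis
        using step(3) by (auto simp: reach_def intro: converse_rtrancl_into_rtrancl)
    qed
  qed
qed (auto elim: reach_link_mono)

end

section \<open>Star-triangle transformation and planar duality\<close>

type_synonym site = "int \<times> int"

definition direction :: "nat \<Rightarrow> site" where
  "direction k = (if k = 0 then (1, 0) else if k = 1 then (0, 1) else (1, 1))"

text \<open>The triangular lattice drawn on the square grid with one family of diagonals; an edge is
  the pair of its direction 0, 1 or 2 and its base point.\<close>

definition tri_ends :: "nat \<times> site \<Rightarrow> site set" where
  "tri_ends e = {snd e, snd e + direction (fst e)}"

text \<open>
  Cutting each cell of the square grid along its diagonal gives the up triangle with corners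
  \<open>c\<close>, \<open>c + (1, 0)\<close>, \<open>c + (1, 1)\<close> and the down triangle with corners \<open>c\<close>, \<open>c + (0, 1)\<close>, \<open>c + (1, 1)\<close>.
  The site \<open>c\<close> also names the down triangle of its cell, and the three sides of an up triangle are
  paired with the down triangles on their other side.
\<close>

definition legs :: "site \<Rightarrow> ((nat \<times> site) \<times> site) set" where
  "legs c = {((0, c), c - (0, 1)), ((1, c + (1, 0)), c + (1, 0)), ((2, c), c)}"

definition star_edges :: "site set \<Rightarrow> (nat \<times> site) set" where
  "star_edges B = (\<Union>c\<in>B. {(0, c), (1, c + (1, 0)), (2, c)})"

text \<open>The three down triangles around the up triangle of c, named as in \<open>legs\<close>,
  are joined in pairs. This gives edges of a triangular lattice again, and different c give
  different edges.\<close>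

definition triangle_edges :: "site set \<Rightarrow> (nat \<times> site) set" where
  "triangle_edges B = (\<Union>c\<in>B. {(0, c), (1, c - (0, 1)), (2, c - (0, 1))})"

text \<open>A leg crosses its side and is open exactly when that side is closed. The centres of the
  stars are eliminated: two down triangles are linked when both their legs are open.\<close>

definition star_link :: "site set \<Rightarrow> (nat \<times> site) set \<Rightarrow> site rel" where
  "star_link B \<omega> = {(x, y). \<exists>c\<in>B. \<exists>e f. (e, x) \<in> legs c \<and> (f, y) \<in> legs c \<and> e \<notin> \<omega> \<and> f \<notin> \<omega>}"

section \<open>Replacing stars by triangles\<close>

lemma link_Un: "link \<epsilon> (\<omega> \<union> \<eta>) = link \<epsilon> \<omega> \<union> link \<epsilon> \<eta>"
  by (auto simp: link_def)

lemma link_empty [simp]: "link \<epsilon> {} = {}"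
  by (auto simp: link_def)

text \<open>Each block joins none, one pair or all of the sites c, c + (1, 0), c - (0, 1). Joining a
  given pair only has the same weight in both blocks, and the critical inequality says that the
  triangle joins all three at least as likely as the star. Any functional G that increases with the
  connections therefore gains.\<close>

lemma star_triangle_block:
  fixes G :: "site rel \<Rightarrow> real"
  assumes q: "range q \<subseteq> {0..1}" "\<And>k x y. q (k, x) = q (k, y)"
    and crit: "1 \<le> q (0, c) + q (1, c) + q (2, c) - q (0, c) * q (1, c) * q (2, c)"
    and G: "\<And>R R'. R \<subseteq> R'\<^sup>* \<Longrightarrow> G R \<le> G R'"
  shows "bexp q (star_edges {c}) (\<lambda>\<eta>. G (R \<union> star_link {c} \<eta>))
    \<le> bexp q (triangle_edges {c}) (\<lambda>\<eta>. G (R \<union> link tri_ends \<eta>))"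
proof -
  obtain i j where c: "c = (i, j)" by (cases c)
  define a0 a1 a2 where a: "a0 = q (0, c)" "a1 = q (1, c)" "a2 = q (2, c)"
  have "q e \<in> {0..1}" for e
    using q(1) by blast
  hence q01: "0 \<le> q e" "q e \<le> 1" for e
    by simp_all
  let ?L = "\<lambda>S. link tri_ends S"
  let ?t0 = "(0, c) :: nat \<times> site" and ?t1 = "(1, c - (0, 1)) :: nat \<times> site" and ?t2 = "(2, c - (0, 1)) :: nat \<times> site"
  let ?e1 = "(1, c + (1, 0)) :: nat \<times> site" and ?e2 = "(2, c) :: nat \<times> site"
  let ?g = "\<lambda>S. G (R \<union> ?L S)"
  let ?f = "\<lambda>\<eta>. G (R \<union> star_link {c} \<eta>)"
  have le: "?f \<eta> \<le> ?g S" if "star_link {c} \<eta> \<subseteq> (?L S)\<^sup>*" for \<eta> S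
    using that rtrancl_mono[of "?L S" "R \<union> ?L S"] by (intro G) auto
  have ge: "?g S \<le> ?g S'" if "?L S \<subseteq> (?L S')\<^sup>*" for S S'
    using that rtrancl_mono[of "?L S'" "R \<union> ?L S'"] by (intro G) auto
  have L: "(c, c + (1, 0)) \<in> ?L S \<and> (c + (1, 0), c) \<in> ?L S" if "?t0 \<in> S" for S
    using that by (force simp: link_def tri_ends_def direction_def)
  have L1: "(c, c - (0, 1)) \<in> ?L S \<and> (c - (0, 1), c) \<in> ?L S" if "?t1 \<in> S" for S
    using that by (force simp: link_def tri_ends_def direction_def)
  have L2: "(c - (0, 1), c + (1, 0)) \<in> ?L S \<and> (c + (1, 0), c - (0, 1)) \<in> ?L S" if "?t2 \<in> S" for S
    using that by (force simp: link_def tri_ends_def direction_def c)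
  have all: "{c, c + (1, 0), c - (0, 1)} \<times> {c, c + (1, 0), c - (0, 1)} \<subseteq> (?L S)\<^sup>*"
    if "?t0 \<in> S \<and> ?t1 \<in> S \<or> ?t0 \<in> S \<and> ?t2 \<in> S \<or> ?t1 \<in> S \<and> ?t2 \<in> S" for S
    using that
  proof (elim disjE conjE)
    assume "?t0 \<in> S" "?t1 \<in> S"
    note L(1)[OF this(1)] L1[OF this(2)]
    thus ?thesis
      by (auto intro: converse_rtrancl_into_rtrancl)
  next
    assume "?t0 \<in> S" "?t2 \<in> S"
    note L(1)[OF this(1)] L2[OF this(2)]
    thus ?thesis
      by (auto intro: converse_rtrancl_into_rtrancl)
  next
    assume "?t1 \<in> S" "?t2 \<in> S"
    note L1[OF this(1)] L2[OF this(2)]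
    thus ?thesis
      by (auto intro: converse_rtrancl_into_rtrancl)
  qed
  let ?all = "{?t0, ?t1, ?t2}"
  have sub_all: "?L S \<subseteq> {c, c + (1, 0), c - (0, 1)} \<times> {c, c + (1, 0), c - (0, 1)}" if "S \<subseteq> ?all" for S
  proof -
    have "tri_ends ?t0 = {c, c + (1, 0)}" "tri_ends ?t1 = {c - (0, 1), c}"
      "tri_ends ?t2 = {c - (0, 1), c + (1, 0)}"
      by (simp_all add: tri_ends_def direction_def c)
    hence ends: "tri_ends e \<subseteq> {c, c + (1, 0), c - (0, 1)}" if "e \<in> ?all" for e
      using that by (elim insertE emptyE) simp_all
    show ?thesis
    proof (rule subrelI)
      fix x y assume "(x, y) \<in> ?L S"
      then obtain e where "e \<in> S" "tri_ends e = {x, y}"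
        by (auto simp: link_def)
      thus "(x, y) \<in> {c, c + (1, 0), c - (0, 1)} \<times> {c, c + (1, 0), c - (0, 1)}"
        using ends[of e] that by auto
    qed
  qed
  have star: "star_link {c} \<eta> \<subseteq> {c, c + (1, 0), c - (0, 1)} \<times> {c, c + (1, 0), c - (0, 1)}" for \<eta>
    by (auto simp: star_link_def legs_def)
  have f3: "?f {} \<le> ?g ?all"
    using all[of ?all] star by (intro le) blast
  have f0: "?f {?t0} \<le> ?g {?t0}"
    using L[of "{?t0}"] by (intro le) (auto simp: star_link_def legs_def c)
  have f1: "?f {?e1} \<le> ?g {?t1}"
    using L1[of "{?t1}"] by (intro le) (auto simp: star_link_def legs_def c)
  have f2: "?f {?e2} \<le> ?g {?t2}"
    using L2[of "{?t2}"] by (intro le) (auto simp: star_link_def legs_def c)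
  have fm: "?f {?t0, ?e1} \<le> ?g {}" "?f {?t0, ?e2} \<le> ?g {}" "?f {?e1, ?e2} \<le> ?g {}"
      "?f {?t0, ?e1, ?e2} \<le> ?g {}"
    by (intro le; auto simp: star_link_def legs_def c)+
  have gm: "?g ?all \<le> ?g {?t0, ?t1}" "?g ?all \<le> ?g {?t0, ?t2}" "?g ?all \<le> ?g {?t1, ?t2}"
    using all[of "{?t0, ?t1}"] all[of "{?t0, ?t2}"] all[of "{?t1, ?t2}"] sub_all[of ?all]
    by (intro ge; blast)+
  have g03: "?g {} \<le> ?g ?all"
    by (intro ge) auto
  have S: "star_edges {c} = {?t0, ?e1, ?e2}" "triangle_edges {c} = ?all"
    by (auto simp: star_edges_def triangle_edges_def)
  have qe: "q ?t0 = a0" "q ?e1 = a1" "q ?e2 = a2" "q ?t1 = a1" "q ?t2 = a2"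
    using q(2) by (simp_all add: a)
  have bexp3: "bexp q {x, y, z} F = q x * q y * q z * F {x, y, z}
      + q x * q y * (1 - q z) * F {x, y} + q x * (1 - q y) * q z * F {x, z}
      + (1 - q x) * q y * q z * F {y, z} + q x * (1 - q y) * (1 - q z) * F {x}
      + (1 - q x) * q y * (1 - q z) * F {y} + (1 - q x) * (1 - q y) * q z * F {z}
      + (1 - q x) * (1 - q y) * (1 - q z) * F {}"
    if "x \<noteq> y" "x \<noteq> z" "y \<noteq> z" for x y z and F :: "(nat \<times> site) set \<Rightarrow> real"
    using that by (simp add: bexp_insert algebra_simps)
  have a01: "0 \<le> a0" "0 \<le> a1" "0 \<le> a2" "0 \<le> 1 - a0" "0 \<le> 1 - a1" "0 \<le> 1 - a2"
    using q01 by (simp_all add: a)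
  \<comment> \<open>m is the probability of at least two open sides and r that of none. The triangle
    joins all three sites with probability m and none with probability r, the star the other way
    round; \<open>crit\<close> amounts to m - r \<ge> 0.\<close>
  define m where "m = a0 * a1 * a2 + a0 * a1 * (1 - a2) + a0 * (1 - a1) * a2 + (1 - a0) * a1 * a2"
  define s where "s = a0 * (1 - a1) * (1 - a2) * ?g {?t0} + (1 - a0) * a1 * (1 - a2) * ?g {?t1}
      + (1 - a0) * (1 - a1) * a2 * ?g {?t2}"
  define r where "r = (1 - a0) * (1 - a1) * (1 - a2)"
  have "bexp q (star_edges {c}) ?f = a0 * a1 * a2 * ?f {?t0, ?e1, ?e2}
      + a0 * a1 * (1 - a2) * ?f {?t0, ?e1} + a0 * (1 - a1) * a2 * ?f {?t0, ?e2}
      + (1 - a0) * a1 * a2 * ?f {?e1, ?e2} + a0 * (1 - a1) * (1 - a2) * ?f {?t0}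
      + (1 - a0) * a1 * (1 - a2) * ?f {?e1} + (1 - a0) * (1 - a1) * a2 * ?f {?e2}
      + (1 - a0) * (1 - a1) * (1 - a2) * ?f {}"
    unfolding S by (subst bexp3) (auto simp only: qe prod.inject zero_neq_one one_neq_zero)
  also have "\<dots> \<le> a0 * a1 * a2 * ?g {}
      + a0 * a1 * (1 - a2) * ?g {} + a0 * (1 - a1) * a2 * ?g {}
      + (1 - a0) * a1 * a2 * ?g {} + a0 * (1 - a1) * (1 - a2) * ?g {?t0}
      + (1 - a0) * a1 * (1 - a2) * ?g {?t1} + (1 - a0) * (1 - a1) * a2 * ?g {?t2}
      + (1 - a0) * (1 - a1) * (1 - a2) * ?g ?all"
    by (intro add_mono mult_left_mono fm f0 f1 f2 f3 mult_nonneg_nonneg a01)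
  also have "\<dots> = m * ?g {} + s + r * ?g ?all"
    by (simp add: m_def s_def r_def algebra_simps)
  also have "\<dots> \<le> m * ?g ?all + s + r * ?g {}"
  proof -
    have "0 \<le> (m - r) * (?g ?all - ?g {})"
      using crit g03 by (intro mult_nonneg_nonneg) (simp_all add: m_def r_def a algebra_simps)
    thus ?thesis
      by (simp add: algebra_simps)
  qed
  also have "\<dots> = a0 * a1 * a2 * ?g ?all
      + a0 * a1 * (1 - a2) * ?g ?all + a0 * (1 - a1) * a2 * ?g ?all
      + (1 - a0) * a1 * a2 * ?g ?all + a0 * (1 - a1) * (1 - a2) * ?g {?t0}
      + (1 - a0) * a1 * (1 - a2) * ?g {?t1} + (1 - a0) * (1 - a1) * a2 * ?g {?t2}
      + (1 - a0) * (1 - a1) * (1 - a2) * ?g {}"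
    by (simp add: m_def s_def r_def algebra_simps)
  also have "\<dots> \<le> a0 * a1 * a2 * ?g ?all
      + a0 * a1 * (1 - a2) * ?g {?t0, ?t1} + a0 * (1 - a1) * a2 * ?g {?t0, ?t2}
      + (1 - a0) * a1 * a2 * ?g {?t1, ?t2} + a0 * (1 - a1) * (1 - a2) * ?g {?t0}
      + (1 - a0) * a1 * (1 - a2) * ?g {?t1} + (1 - a0) * (1 - a1) * a2 * ?g {?t2}
      + (1 - a0) * (1 - a1) * (1 - a2) * ?g {}"
    by (intro add_mono mult_left_mono gm order_refl mult_nonneg_nonneg a01)
  also have "\<dots> = bexp q (triangle_edges {c}) ?g"
    unfolding S by (subst bexp3) (auto simp only: qe prod.inject zero_neq_one one_neq_zero)
  finally show ?thesis .
qed

text \<open>Stars are replaced one at a time. The induction is over arbitrary R, which carries the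
  links of other blocks while one block is changed.\<close>

lemma star_le_triangle:
  assumes q: "range q \<subseteq> {0..1}" "\<And>k x y. q (k, x) = q (k, y)"
    and crit: "\<And>c. 1 \<le> q (0, c) + q (1, c) + q (2, c) - q (0, c) * q (1, c) * q (2, c)"
    and "finite B"
  shows "bexp q (star_edges B) (\<lambda>\<omega>. of_bool (reach (R \<union> star_link B \<omega>) W T))
    \<le> bexp q (triangle_edges B) (\<lambda>\<omega>. of_bool (reach (R \<union> link tri_ends \<omega>) W T))"
  using \<open>finite B\<close>
proof (induction B arbitrary: R rule: finite_induct)
  case empty
  thus ?case
    by (simp add: star_edges_def triangle_edges_def star_link_def)
next
  case (insert c B)
  let ?G = "\<lambda>R. bexp q (triangle_edges B) (\<lambda>\<omega>. of_bool (reach (R \<union> link tri_ends \<omega>) W T))"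
  have fin: "finite (star_edges C)" "finite (triangle_edges C)" if "finite C" for C
    using that by (auto simp: star_edges_def triangle_edges_def)
  have split: "star_edges (insert c B) = star_edges {c} \<union> star_edges B"
    "triangle_edges (insert c B) = triangle_edges {c} \<union> triangle_edges B"
    by (auto simp: star_edges_def triangle_edges_def)
  have disj: "star_edges {c} \<inter> star_edges B = {}" "triangle_edges {c} \<inter> triangle_edges B = {}"
    using insert.hyps by (auto simp: star_edges_def triangle_edges_def)
  have G: "?G R \<le> ?G R'" if "R \<subseteq> R'\<^sup>*" for R R'
  proof (intro bexp_mono q(1))
    fix \<omega>
    have "R \<union> link tri_ends \<omega> \<subseteq> (R' \<union> link tri_ends \<omega>)\<^sup>*"
      using that rtrancl_mono[of R' "R' \<union> link tri_ends \<omega>"] by auto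
    hence "reach (R' \<union> link tri_ends \<omega>) W T" if "reach (R \<union> link tri_ends \<omega>) W T"
      using that by (auto elim: reach_mono)
    thus "of_bool (reach (R \<union> link tri_ends \<omega>) W T) \<le> (of_bool (reach (R' \<union> link tri_ends \<omega>) W T) :: real)"
      by auto
  qed
  have "bexp q (star_edges (insert c B)) (\<lambda>\<omega>. of_bool (reach (R \<union> star_link (insert c B) \<omega>) W T))
      = bexp q (star_edges {c}) (\<lambda>\<eta>. bexp q (star_edges B)
          (\<lambda>\<omega>. of_bool (reach (R \<union> star_link (insert c B) (\<eta> \<union> \<omega>)) W T)))"
    unfolding split using insert.hyps disj by (intro bexp_Un fin) auto
  also have "\<dots> = bexp q (star_edges {c}) (\<lambda>\<eta>. bexp q (star_edges B)
          (\<lambda>\<omega>. of_bool (reach ((R \<union> star_link {c} \<eta>) \<union> star_link B \<omega>) W T)))"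
  proof (intro bexp_cong)
    fix \<eta> \<omega> assume sub: "\<eta> \<subseteq> star_edges {c}" "\<omega> \<subseteq> star_edges B"
    have leg: "e \<in> star_edges {c'}" if "(e, x) \<in> legs c'" for e x c'
      using that by (auto simp: legs_def star_edges_def)
    have "e \<notin> \<omega>" if "(e, x) \<in> legs c" for e x
      using leg[OF that] sub disj by blast
    moreover have "e \<notin> \<eta>" if "(e, x) \<in> legs c'" "c' \<in> B" for e x c'
      using leg[OF that(1)] that(2) sub disj by (auto simp: star_edges_def)
    ultimately have "star_link (insert c B) (\<eta> \<union> \<omega>) = star_link {c} \<eta> \<union> star_link B \<omega>"
      unfolding star_link_def by blast
    thus "of_bool (reach (R \<union> star_link (insert c B) (\<eta> \<union> \<omega>)) W T)
        = (of_bool (reach ((R \<union> star_link {c} \<eta>) \<union> star_link B \<omega>) W T) :: real)"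
      by (simp only: Un_assoc)
  qed
  also have "\<dots> \<le> bexp q (star_edges {c}) (\<lambda>\<eta>. ?G (R \<union> star_link {c} \<eta>))"
    by (intro bexp_mono q insert.IH)
  also have "\<dots> \<le> bexp q (triangle_edges {c}) (\<lambda>\<eta>. ?G (R \<union> link tri_ends \<eta>))"
    by (intro star_triangle_block q crit G)
  also have "\<dots> = bexp q (triangle_edges (insert c B)) (\<lambda>\<omega>. of_bool (reach (R \<union> link tri_ends \<omega>) W T))"
    unfolding split using insert.hyps disj by (subst bexp_Un) (auto simp: fin link_Un Un_assoc)
  finally show ?case .
qed

section \<open>Crossing duality by parity counting\<close>

lemma sum_telescope_bit: "(\<Sum>i<n. f i + f (Suc i)) = f 0 + (f n :: bit)"
proof (induction n)
  case (Suc n)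
  have "(\<Sum>i<Suc n. f i + f (Suc i)) = (f 0 + f n) + (f n + f (Suc n))"
    by (simp only: sum.lessThan_Suc Suc.IH)
  also have "\<dots> = f 0 + f (Suc n)"
    by (cases "f 0"; cases "f n"; cases "f (Suc n)") simp_all
  finally show ?case .
qed simp

text \<open>
  Let \<open>A\<close> be the set of sites joined to the left side and \<open>K\<close> the set of down triangles joined to the bottom.
  Each triangle has an even number of sides separating \<open>A\<close> from its complement, so counting these sides
  modulo 2 over the triangles belonging to \<open>K\<close> leaves only the bottom row, which has an odd number of
  them unless \<open>A\<close> reaches the right side or \<open>K\<close> reaches the top.
\<close>

lemma crossing_duality:
  fixes n :: nat
  assumes "0 < n"
  defines "B \<equiv> {0..<int n} \<times> {0..<int n}"
  shows "(\<exists>j\<in>{0..int n}. reach (link tri_ends (\<omega> \<inter> star_edges B)) {(0, j)} {y. int n \<le> fst y}) \<or>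
    (\<exists>i\<in>{0..<int n}. reach (star_link B \<omega>) {(i, -1)} {y. int n - 1 \<le> snd y})"
proof (rule ccontr)
  assume no: "\<not> ?thesis"
  define L where "L = link tri_ends (\<omega> \<inter> star_edges B)"
  define A where "A = {y. \<exists>j\<in>{0..int n}. ((0, j), y) \<in> L\<^sup>*}"
  define K where "K = {y. \<exists>i\<in>{0..<int n}. ((i, -1), y) \<in> (star_link B \<omega>)\<^sup>*}"
  have A_right: "v \<notin> A" if "int n \<le> fst v" for v
    using no that unfolding A_def L_def reach_def by blast
  have A_left: "(0, j) \<in> A" if "0 \<le> j" "j \<le> int n" for j
    using that by (auto simp: A_def)
  have K_top: "v \<notin> K" if "int n - 1 \<le> snd v" for v
    using no that unfolding K_def reach_def by blast
  have K_bot: "(i, -1) \<in> K" if "0 \<le> i" "i < int n" for i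
    using that by (auto simp: K_def)
  have A_step: "y \<in> A" if "x \<in> A" "(x, y) \<in> L" for x y
    using that by (auto simp: A_def intro: rtrancl.rtrancl_into_rtrancl)
  have K_step: "y \<in> K" if "x \<in> K" "(x, y) \<in> star_link B \<omega>" for x y
    using that by (auto simp: K_def intro: rtrancl.rtrancl_into_rtrancl)
  have closed: "e \<notin> \<omega>" if "e \<in> star_edges B" "(snd e \<in> A) \<noteq> (snd e + direction (fst e) \<in> A)" for e
  proof
    assume "e \<in> \<omega>"
    hence "(snd e, snd e + direction (fst e)) \<in> L" "(snd e + direction (fst e), snd e) \<in> L"
      using that(1) by (auto simp: L_def link_def tri_ends_def)
    thus False
      using that(2) A_step by blast
  qed
  have K_eq: "x \<in> K \<longleftrightarrow> y \<in> K" if "c \<in> B" "(e, x) \<in> legs c" "(f, y) \<in> legs c" "e \<notin> \<omega>" "f \<notin> \<omega>" for c e f x y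
  proof -
    have "(x, y) \<in> star_link B \<omega>" "(y, x) \<in> star_link B \<omega>"
      using that unfolding star_link_def by blast+
    thus ?thesis
      using K_step by blast
  qed
  let ?k = "\<lambda>i j. of_bool ((i, j) \<in> K) :: bit"
  let ?h = "\<lambda>i j. of_bool (((i, j) \<in> A) \<noteq> ((i + 1, j) \<in> A)) :: bit"
  let ?v = "\<lambda>i j. of_bool (((i, j) \<in> A) \<noteq> ((i, j + 1) \<in> A)) :: bit"
  \<comment> \<open>\<open>?h\<close> and \<open>?v\<close> mark the horizontal and vertical edges
    that separate A from its complement; \<open>?P\<close> and \<open>?Q\<close> keep those whose
    down triangle, below or to the right, lies in K.\<close>
  let ?P = "\<lambda>i j. ?k i (j - 1) * ?h i j" and ?Q = "\<lambda>i j. ?k i j * ?v i j"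
  \<comment> \<open>If the up triangle has separating sides, there are two of them, both closed, so
    their down triangles are linked and both or neither lie in K. The down triangle contributes an
    even count of its own. The diagonal has weight \<open>?k i j\<close> in both triangles of the
    cell and cancels.\<close>
  have cell: "(?P i j + ?P i (j + 1)) + (?Q i j + ?Q (i + 1) j) = 0"
    if "0 \<le> i" "i < int n" "0 \<le> j" "j < int n" for i j
  proof -
    have c: "(i, j) \<in> B"
      using that by (auto simp: B_def)
    have mem: "(0, (i, j)) \<in> star_edges B" "(1, (i + 1, j)) \<in> star_edges B" "(2, (i, j)) \<in> star_edges B"
      using c by (force simp: star_edges_def)+
    have cl: "((i, j) \<in> A) \<noteq> ((i + 1, j) \<in> A) \<Longrightarrow> (0, (i, j)) \<notin> \<omega>"
      "((i + 1, j) \<in> A) \<noteq> ((i + 1, j + 1) \<in> A) \<Longrightarrow> (1, (i + 1, j)) \<notin> \<omega>"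
      "((i, j) \<in> A) \<noteq> ((i + 1, j + 1) \<in> A) \<Longrightarrow> (2, (i, j)) \<notin> \<omega>"
      using closed[OF mem(1)] closed[OF mem(2)] closed[OF mem(3)] by (auto simp: direction_def)
    have lg: "((0, (i, j)), (i, j - 1)) \<in> legs (i, j)" "((1, (i + 1, j)), (i + 1, j)) \<in> legs (i, j)"
      "((2, (i, j)), (i, j)) \<in> legs (i, j)"
      by (auto simp: legs_def)
    note k = K_eq[OF c lg(1) lg(2)] K_eq[OF c lg(1) lg(3)] K_eq[OF c lg(2) lg(3)]
    show ?thesis
      using cl k
      by (cases "(i, j) \<in> A"; cases "(i + 1, j) \<in> A"; cases "(i + 1, j + 1) \<in> A"; cases "(i, j + 1) \<in> A") auto
  qed
  let ?s = "\<lambda>i j. (?P (int i) (int j) + ?P (int i) (int j + 1)) + (?Q (int i) (int j) + ?Q (int i + 1) (int j))"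
  have "0 = (\<Sum>i<n. \<Sum>j<n. ?s i j)"
    using cell by (intro sum.neutral[symmetric] ballI) auto
  also have "\<dots> = (\<Sum>i<n. \<Sum>j<n. ?P (int i) (int j) + ?P (int i) (int (Suc j)))
      + (\<Sum>j<n. \<Sum>i<n. ?Q (int i) (int j) + ?Q (int (Suc i)) (int j))"
    by (subst (3) sum.swap) (simp only: sum.distrib of_nat_Suc add.commute[of 1])
  also have "\<dots> = (\<Sum>i<n. ?P (int i) 0 + ?P (int i) (int n)) + (\<Sum>j<n. ?Q 0 (int j) + ?Q (int n) (int j))"
    by (subst sum_telescope_bit sum_telescope_bit[of "\<lambda>i. ?Q (int i) _"])+ simp
  \<comment> \<open>Only the frame is left. The left side is in A and the right side outside A, so
    neither has separating edges; the row n - 1 of triangles misses K, and the row -1 below the box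
    belongs to K.\<close>
  also have "\<dots> = (\<Sum>i<n. ?h (int i) 0) + (\<Sum>j<n. 0)"
    using A_left A_right K_top K_bot by (intro arg_cong2[where f = "(+)"] sum.cong) auto
  also have "(\<Sum>i<n. ?h (int i) 0)
      = (\<Sum>i<n. of_bool ((int i, 0) \<in> A) + of_bool ((int (Suc i), 0) \<in> A))"
    by (intro sum.cong) (auto simp: add.commute)
  also have "\<dots> = of_bool ((0, 0) \<in> A) + of_bool ((int n, 0) \<in> A)"
    by (subst sum_telescope_bit) simp
  also have "\<dots> = 1"
    using A_left[of 0] A_right[of "(int n, 0)"] by simp
  finally show False by simp
qed

section \<open>Projection of the cubic lattice\<close>

lemma lattice_dist_one:
  assumes "x \<in> lattice d" "y \<in> lattice d" "lattice_dist d x y = 1"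
  obtains i s where "i < d" "s \<in> {1, -1}" "y = x(i := x i + s)"
proof -
  have "\<exists>i<d. x i \<noteq> y i"
  proof (rule ccontr)
    assume "\<not> ?thesis"
    hence "lattice_dist d x y = 0"
      by (simp add: lattice_dist_def)
    thus False using assms by simp
  qed
  then obtain i where i: "i < d" "x i \<noteq> y i" by blast
  have "lattice_dist d x y = \<bar>x i - y i\<bar> + (\<Sum>j\<in>{..<d} - {i}. \<bar>x j - y j\<bar>)"
    unfolding lattice_dist_def using i by (intro sum.remove) auto
  moreover have "0 \<le> (\<Sum>j\<in>{..<d} - {i}. \<bar>x j - y j\<bar>)"
    by (intro sum_nonneg) auto
  ultimately have one: "\<bar>x i - y i\<bar> = 1" and zero: "(\<Sum>j\<in>{..<d} - {i}. \<bar>x j - y j\<bar>) = 0"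
    using assms i by linarith+
  have "x j = y j" if "j \<noteq> i" for j
  proof (cases "j < d")
    case True
    have "\<forall>j\<in>{..<d} - {i}. \<bar>x j - y j\<bar> = 0"
      using zero by (subst (asm) sum_nonneg_eq_0_iff) auto
    thus ?thesis using True that by auto
  next
    case False
    thus ?thesis using assms by (simp add: lattice_def)
  qed
  hence "y = x(i := x i + (y i - x i))" by (auto simp: fun_eq_iff)
  moreover have "y i - x i \<in> {1, -1}"
    using one by auto
  ultimately show thesis
    using that i by blast
qed

lemma lattice_step:
  assumes "x \<in> lattice d" "i < d" "s \<in> {1, -1}"
  shows "x(i := x i + s) \<in> lattice d" "{x, x(i := x i + s)} \<in> lattice_edges d"
proof -
  show mem: "x(i := x i + s) \<in> lattice d"
    using assms by (auto simp: lattice_def)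
  have "lattice_dist d x (x(i := x i + s)) = (\<Sum>j<d. if j = i then \<bar>s\<bar> else 0)"
    unfolding lattice_dist_def by (intro sum.cong) auto
  also have "\<dots> = 1"
    using assms by auto
  finally show "{x, x(i := x i + s)} \<in> lattice_edges d"
    using assms mem by (auto simp: lattice_edges_def)
qed

lemma lattice_dist_commute: "lattice_dist d x y = lattice_dist d y x"
  by (simp add: lattice_dist_def abs_minus_commute)

lemma lattice_edges_iff:
  "{x, y} \<in> lattice_edges d \<longleftrightarrow> x \<in> lattice d \<and> y \<in> lattice d \<and> lattice_dist d x y = 1"
  using lattice_dist_commute[of d x y] by (auto simp: lattice_edges_def doubleton_eq_iff)

interpretation lattice_graph: locally_finite_graph "lattice_edges d" for d
proof
  fix e assume "e \<in> lattice_edges d"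
  then obtain x y where "e = {x, y}" "lattice_dist d x y = 1"
    by (auto simp: lattice_edges_def)
  moreover from this(2) have "x \<noteq> y"
    by (auto simp: lattice_dist_def)
  ultimately show "\<exists>x y. x \<noteq> y \<and> e = {x, y}"
    by blast
next
  fix x
  have "{e \<in> lattice_edges d. x \<in> e} \<subseteq> (\<lambda>(i, s). {x, x(i := x i + s)}) ` ({..<d} \<times> {1, -1})"
  proof
    fix e assume e: "e \<in> {e \<in> lattice_edges d. x \<in> e}"
    then obtain u v where "e = {u, v}" "x \<in> {u, v}"
      by (auto simp: lattice_edges_def)
    then obtain y where y: "e = {x, y}"
      by auto
    hence "x \<in> lattice d" "y \<in> lattice d" "lattice_dist d x y = 1"
      using e lattice_edges_iff by auto
    then obtain i s where "i < d" "s \<in> {1, -1}" "y = x(i := x i + s)"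
      by (rule lattice_dist_one)
    thus "e \<in> (\<lambda>(i, s). {x, x(i := x i + s)}) ` ({..<d} \<times> {1, -1})"
      using y by (intro image_eqI[of _ _ "(i, s)"]) auto
  qed
  thus "finite {e \<in> lattice_edges d. x \<in> e}"
    by (rule finite_subset) auto
qed

section \<open>Translations and the folding map\<close>

definition shift :: "vertex \<Rightarrow> vertex \<Rightarrow> vertex" where
  "shift x y = (\<lambda>i. x i + y i)"

lemma bij_shift: "bij (shift x)"
  by (rule bij_betw_byWitness[where f' = "shift (\<lambda>i. - x i)"]) (auto simp: shift_def)

lemma shift_lattice: "x \<in> lattice d \<Longrightarrow> shift x y \<in> lattice d \<longleftrightarrow> y \<in> lattice d"
  by (auto simp: shift_def lattice_def)

lemma shift_edges: "x \<in> lattice d \<Longrightarrow> {shift x a, shift x b} \<in> lattice_edges d \<longleftrightarrow> {a, b} \<in> lattice_edges d"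
  by (simp add: lattice_edges_iff shift_lattice) (simp add: lattice_dist_def shift_def)

definition proj :: "nat \<Rightarrow> vertex \<Rightarrow> site" where
  "proj d x = (\<Sum>i<d. x i * fst (direction (i mod 3)), \<Sum>i<d. x i * snd (direction (i mod 3)))"

lemma proj_shift: "proj d (shift x y) = proj d x + proj d y"
  by (simp add: proj_def shift_def sum.distrib algebra_simps)

lemma proj_zero: "proj d (\<lambda>_. 0) = 0"
  by (simp add: proj_def zero_prod_def)

lemma proj_step:
  assumes "i < d"
  shows "proj d (x(i := x i + s)) =
    proj d x + (s * fst (direction (i mod 3)), s * snd (direction (i mod 3)))"
proof -
  have "(\<Sum>j<d. (x(i := x i + s)) j * w j) = (\<Sum>j<d. x j * w j) + s * w i" for w :: "nat \<Rightarrow> int"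
  proof -
    have "(\<Sum>j<d. (x(i := x i + s)) j * w j) = (\<Sum>j<d. x j * w j + (if j = i then s * w i else 0))"
      by (intro sum.cong) (auto simp: algebra_simps)
    thus ?thesis
      using assms by (simp add: sum.distrib)
  qed
  thus ?thesis
    by (simp add: proj_def)
qed

lemma proj_surj:
  assumes "d \<ge> 3"
  shows "\<exists>x\<in>lattice d. proj d x = a"
proof -
  let ?x = "\<lambda>_::nat. 0 :: int"
  let ?y = "?x(0 := ?x 0 + fst a)"
  let ?z = "?y(1 := ?y 1 + snd a)"
  have "proj d ?z = proj d ?y + (0, snd a)"
    using assms by (subst proj_step) (simp_all add: direction_def)
  also have "proj d ?y = proj d ?x + (fst a, 0)"
    using assms by (subst proj_step) (simp_all add: direction_def)
  also have "proj d ?x + (fst a, 0) + (0, snd a) = a"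
    by (simp add: proj_zero)
  finally have "proj d ?z = a" .
  moreover have "?z \<in> lattice d"
    using assms by (auto simp: lattice_def)
  ultimately show ?thesis by blast
qed

definition multiplicity3 :: "nat \<Rightarrow> nat \<Rightarrow> nat" where
  "multiplicity3 d k = card {i. i < d \<and> i mod 3 = k}"

text \<open>The probability that at least one of n_k independent edges is open, where n_k
  coordinates are folded onto direction k.\<close>

definition tri_prob :: "nat \<Rightarrow> real \<Rightarrow> nat \<times> site \<Rightarrow> real" where
  "tri_prob d p e = 1 - (1 - p) ^ multiplicity3 d (fst e)"

lemma tri_prob_range:
  assumes "p \<in> {0..1}"
  shows "range (tri_prob d p) \<subseteq> {0..1}"
  using assms by (auto simp: tri_prob_def power_le_one)

text \<open>Absence of parallel edges keeps the lifts of different edges apart.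
  \<open>direction\<close> sends every k \<ge> 2 to the diagonal, whence the bound on k.\<close>

lemma inj_on_tri_ends: "inj_on tri_ends {e. fst e < 3}"
proof (rule inj_onI, clarsimp)
  fix k i j k' i' j'
  assume "k < 3" "k' < 3" "tri_ends (k, i, j) = tri_ends (k', i', j')"
  thus "k = k' \<and> i = i' \<and> j = j'"
    by (auto simp: tri_ends_def direction_def doubleton_eq_iff split: if_splits)
qed

text \<open>Traversing e in a fixed sense is a step s = 1 or s = -1 in any coordinate congruent to
  its direction modulo 3, and each such coordinate gives a separate edge at x. With these lifts the
  last inequality is an equality.\<close>

lemma tri_edge_lift:
  assumes "fst e < 3" "tri_ends e = {a, b}" "x \<in> lattice d" "proj d x = a"
  shows "\<exists>N. finite N \<and> N \<subseteq> lattice_edges d \<and>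
    (\<forall>g\<in>N. \<exists>y\<in>lattice d. g = {x, y} \<and> proj d y = b) \<and> (1 - p) ^ card N \<le> 1 - tri_prob d p e"
proof -
  obtain k c where e: "e = (k, c)" by (cases e)
  let ?d = "direction k"
  have "\<exists>s\<in>{1, -1}. b = a + (s * fst ?d, s * snd ?d)"
    using assms(2) unfolding tri_ends_def e
    by (cases c; cases a; cases b; cases ?d) (auto simp: doubleton_eq_iff)
  then obtain s where s: "s \<in> {1, -1}" "b = a + (s * fst ?d, s * snd ?d)" by blast
  let ?I = "{i. i < d \<and> i mod 3 = k}"
  let ?y = "\<lambda>i. x(i := x i + s)"
  let ?N = "(\<lambda>i. {x, ?y i}) ` ?I"
  have "inj_on (\<lambda>i. {x, ?y i}) ?I"
  proof (rule inj_onI)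
    fix i j assume "{x, ?y i} = {x, ?y j}"
    moreover have "?y l l \<noteq> x l" for l
      using s by auto
    hence "?y l \<noteq> x" for l
      by metis
    ultimately have "?y i = ?y j"
      by (auto simp: doubleton_eq_iff)
    hence "?y i i = ?y j i" by simp
    thus "i = j"
      using s by (auto split: if_splits)
  qed
  hence "card ?N = multiplicity3 d k"
    by (simp add: card_image multiplicity3_def)
  moreover have "\<exists>y\<in>lattice d. g = {x, y} \<and> proj d y = b" if g: "g \<in> ?N" for g
  proof -
    obtain i where i: "i < d" "i mod 3 = k" "g = {x, ?y i}"
      using g by auto
    hence "proj d (?y i) = b"
      using proj_step[of i d x s] s assms by simp
    thus ?thesis
      using i lattice_step[OF assms(3) i(1) s(1)] by blast
  qed
  moreover have "?N \<subseteq> lattice_edges d"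
    using lattice_step[OF assms(3) _ s(1)] by blast
  ultimately show ?thesis
    by (intro exI[of _ ?N]) (auto simp: tri_prob_def e)
qed

text \<open>The comparison produces an edge set that is not known in advance, so the bound is
  assumed for every finite edge set and every vertex above a.\<close>

lemma tri_reach_le:
  assumes d: "d \<ge> 3" and p: "p \<in> {0..1}" and "finite F" "F \<subseteq> {e. fst e < 3}"
    and bound: "\<And>E' x. \<lbrakk>finite E'; E' \<subseteq> lattice_edges d; x \<in> lattice d; proj d x = a\<rbrakk> \<Longrightarrow>
      bexp (\<lambda>_. p) E' (\<lambda>\<omega>. of_bool (reach (link (\<lambda>e. e) \<omega>) {x} (proj d -` T))) \<le> C"
  shows "bexp (tri_prob d p) F (\<lambda>\<omega>. of_bool (reach (link tri_ends \<omega>) {a} T)) \<le> C"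
proof -
  obtain x where x: "x \<in> lattice d" "proj d x = a"
    using proj_surj[OF d] by blast
  have "\<exists>E'. finite E' \<and> E' \<subseteq> {g \<in> lattice_edges d. proj d ` g \<in> tri_ends ` F} \<and>
    bexp (tri_prob d p) F (\<lambda>\<omega>. of_bool (reach (link tri_ends \<omega>) {a} T))
      \<le> bexp (\<lambda>_. p) E' (\<lambda>\<omega>. of_bool (reach (link (\<lambda>e. e) \<omega>) {x} (proj d -` T)))"
    using x assms tri_edge_lift
    by (intro bexp_reach_le_lift[OF tri_prob_range[OF p] p inj_on_tri_ends, where V = "lattice d"]) auto
  then obtain E' where "finite E'" "E' \<subseteq> lattice_edges d"
    and E': "bexp (tri_prob d p) F (\<lambda>\<omega>. of_bool (reach (link tri_ends \<omega>) {a} T))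
      \<le> bexp (\<lambda>_. p) E' (\<lambda>\<omega>. of_bool (reach (link (\<lambda>e. e) \<omega>) {x} (proj d -` T)))"
    by blast
  note E'
  also have "bexp (\<lambda>_. p) E' (\<lambda>\<omega>. of_bool (reach (link (\<lambda>e. e) \<omega>) {x} (proj d -` T))) \<le> C"
    by (rule bound) fact+
  finally show ?thesis .
qed

section \<open>Decay along the projection and crossing probabilities of boxes\<close>

lemma lattice_decay:
  fixes d :: nat
  assumes p: "p \<in> {0..1}" and S: "finite S" "(\<lambda>_. 0) \<in> S"
  defines "c \<equiv> lattice_graph.phi d p (\<lambda>_. 0) S"
  obtains L :: nat where "0 < L" "\<And>h k F x T. \<lbrakk>h \<in> {fst, snd}; finite F; F \<subseteq> lattice_edges d; x \<in> lattice d;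
      \<And>y. y \<in> T \<Longrightarrow> h (proj d x) + int k * int L \<le> h (proj d y)\<rbrakk> \<Longrightarrow>
      bexp (\<lambda>_. p) F (\<lambda>\<omega>. of_bool (reach (link (\<lambda>e. e) \<omega>) {x} T)) \<le> c ^ k"
proof -
  let ?B = "S \<union> snd ` lattice_graph.boundary d S"
  \<comment> \<open>L exceeds both projected coordinates of every vertex of S or just outside it;
    the successor makes this strict and L positive.\<close>
  define L where "L = Suc (\<Sum>y\<in>?B. nat \<bar>fst (proj d y)\<bar> + nat \<bar>snd (proj d y)\<bar>)"
  have finB: "finite ?B"
    using S lattice_graph.finite_boundary by auto
  have L: "h (proj d y) < int L" if "y \<in> ?B" "h \<in> {fst, snd}" for h y
  proof -
    have "nat \<bar>fst (proj d y)\<bar> + nat \<bar>snd (proj d y)\<bar> < L"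
      unfolding L_def less_Suc_eq_le using finB that
      by (intro member_le_sum[where f = "\<lambda>y. nat \<bar>fst (proj d y)\<bar> + nat \<bar>snd (proj d y)\<bar>"]) auto
    thus ?thesis
      using that by auto
  qed
  have add: "h (a + b) = h a + h b" if "h \<in> {fst, snd}" for h :: "site \<Rightarrow> int" and a b
    using that by auto
  have c: "0 \<le> c"
    unfolding c_def by (rule lattice_graph.phi_nonneg[OF p S(1)])
  have "bexp (\<lambda>_. p) F (\<lambda>\<omega>. of_bool (reach (link (\<lambda>e. e) \<omega>) {x} T)) \<le> c ^ k"
    if h: "h \<in> {fst, snd}" and F: "finite F" "F \<subseteq> lattice_edges d" and x: "x \<in> lattice d"
      and T: "\<And>y. y \<in> T \<Longrightarrow> h (proj d x) + int k * int L \<le> h (proj d y)" for h k F x T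
  proof (rule lattice_graph.exponential_decay[where V = "lattice d" and S = "\<lambda>x. shift x ` S" and h = "h \<circ> proj d"])
    show "finite (shift x ` S) \<and> x \<in> shift x ` S \<and> lattice_graph.phi d p x (shift x ` S) \<le> c \<and>
        (\<forall>y\<in>shift x ` S. (h \<circ> proj d) y < (h \<circ> proj d) x + int L)" if x: "x \<in> lattice d" for x
    proof (intro conjI ballI)
      have x0: "shift x (\<lambda>_. 0) = x"
        by (simp add: shift_def)
      show "x \<in> shift x ` S"
        using S(2) x0 by force
      show "lattice_graph.phi d p x (shift x ` S) \<le> c"
        using lattice_graph.phi_image_le[OF bij_shift shift_edges[OF x] p S(1), where z = "\<lambda>_. 0"] x0
        by (simp add: c_def)
      fix y assume "y \<in> shift x ` S"
      thus "(h \<circ> proj d) y < (h \<circ> proj d) x + int L"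
        using L h by (auto simp: proj_shift add)
    qed (use S in auto)
    show "b \<in> lattice d \<and> (h \<circ> proj d) b \<le> (h \<circ> proj d) x + int L"
      if x: "x \<in> lattice d" and ab: "(a, b) \<in> lattice_graph.boundary d (shift x ` S)" for x a b
    proof -
      obtain b' where b': "b = shift x b'"
        using bij_shift[of x] by (meson bij_def surj_def)
      obtain a' where a': "a = shift x a'" "a' \<in> S"
        using ab by (auto simp: lattice_graph.boundary_def)
      have "(a', b') \<in> lattice_graph.boundary d S"
        using ab a' b' shift_edges[OF x] by (auto simp: lattice_graph.boundary_def)
      hence "h (proj d b') < int L"
        using L[of b' h] h by force
      moreover have "b \<in> lattice d"
        using ab lattice_edges_iff by (auto simp: lattice_graph.boundary_def)
      ultimately show ?thesis
        by (simp add: b' proj_shift add[OF h])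
    qed
  qed (use p c F x T in auto)
  thus thesis
    by (intro that[of L]) (auto simp: L_def)
qed

text \<open>If c < 1, each of the n + 1 starts on the left and the n starts at the bottom of a box
  of side n = k L leads across with probability at most c^k. Duality forces 1 \<le> (2 n + 1) c^k,
  which fails for large k.\<close>

lemma phi_ge_one:
  assumes d: "d \<ge> 3" and p: "p \<in> {0..1}" and S: "finite S" "(\<lambda>_. 0) \<in> S"
    and crit: "\<And>c. 1 \<le> tri_prob d p (0, c) + tri_prob d p (1, c) + tri_prob d p (2, c)
        - tri_prob d p (0, c) * tri_prob d p (1, c) * tri_prob d p (2, c)"
  shows "1 \<le> lattice_graph.phi d p (\<lambda>_. 0) S"
proof (rule ccontr)
  define c where "c = lattice_graph.phi d p (\<lambda>_. 0) S"
  assume "\<not> ?thesis"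
  hence c1: "c < 1" by (simp add: c_def)
  let ?q = "tri_prob d p"
  note q = tri_prob_range[OF p, of d]
  obtain L where L: "0 < L" and decay: "\<And>h k F x T. \<lbrakk>h \<in> {fst, snd}; finite F; F \<subseteq> lattice_edges d; x \<in> lattice d;
      \<And>y. y \<in> T \<Longrightarrow> h (proj d x) + int k * int L \<le> h (proj d y)\<rbrakk> \<Longrightarrow>
      bexp (\<lambda>_. p) F (\<lambda>\<omega>. of_bool (reach (link (\<lambda>e. e) \<omega>) {x} T)) \<le> c ^ k"
    using lattice_decay[OF p S, of d thesis] unfolding c_def by blast
  have c0: "0 \<le> c"
    unfolding c_def by (rule lattice_graph.phi_nonneg[OF p S(1)])
  have main: "1 \<le> 2 * real L * (real k * c ^ k) + c ^ k" if k: "0 < k" for k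
  proof -
    define n where "n = k * L"
    define B where "B = {0..<int n} \<times> {0..<int n}"
    have n: "0 < n" "int n = int k * int L"
      using k L by (auto simp: n_def)
    have B: "finite B" by (simp add: B_def)
    have fin: "finite (star_edges B)" "finite (triangle_edges B)"
      "star_edges B \<subseteq> {e. fst e < 3}" "triangle_edges B \<subseteq> {e. fst e < 3}"
      using B by (auto simp: star_edges_def triangle_edges_def)
    let ?LR = "\<lambda>j \<omega>. of_bool (reach (link tri_ends \<omega>) {(0, j)} {y. int n \<le> fst y}) :: real"
    \<comment> \<open>The vertical crossing climbs from height -1 to n - 1, that is by n = k L, as
      far as the horizontal one travels. The empty relation is the R of
      \<open>star_le_triangle\<close>.\<close>
    let ?BT = "\<lambda>i \<omega>. of_bool (reach ({} \<union> star_link B \<omega>) {(i, -1)} {y. int n - 1 \<le> snd y}) :: real"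
    have LR: "bexp ?q (star_edges B) (?LR j) \<le> c ^ k" for j
    proof (rule tri_reach_le[OF d p fin(1,3)])
      fix E' x assume "finite E'" "E' \<subseteq> lattice_edges d" "x \<in> lattice d" "proj d x = (0, j)"
      thus "bexp (\<lambda>_. p) E' (\<lambda>\<omega>. of_bool (reach (link (\<lambda>e. e) \<omega>) {x} (proj d -` {y. int n \<le> fst y}))) \<le> c ^ k"
        using n by (intro decay[of fst]) auto
    qed
    have BT: "bexp ?q (star_edges B) (?BT i) \<le> c ^ k" for i
    proof -
      have "bexp ?q (star_edges B) (?BT i) \<le> bexp ?q (triangle_edges B)
          (\<lambda>\<omega>. of_bool (reach ({} \<union> link tri_ends \<omega>) {(i, -1)} {y. int n - 1 \<le> snd y}))"
        using crit by (intro star_le_triangle q B) (auto simp: tri_prob_def)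
      also have "\<dots> \<le> c ^ k"
        unfolding Un_empty_left
      proof (rule tri_reach_le[OF d p fin(2,4)])
        fix E' x assume "finite E'" "E' \<subseteq> lattice_edges d" "x \<in> lattice d" "proj d x = (i, -1)"
        thus "bexp (\<lambda>_. p) E' (\<lambda>\<omega>. of_bool (reach (link (\<lambda>e. e) \<omega>) {x} (proj d -` {y. int n - 1 \<le> snd y}))) \<le> c ^ k"
          using n by (intro decay[of snd]) auto
      qed
      finally show ?thesis .
    qed
    have "1 = bexp ?q (star_edges B) (\<lambda>_. 1)"
      using fin by (simp add: bexp_const)
    also have "\<dots> \<le> bexp ?q (star_edges B) (\<lambda>\<omega>. (\<Sum>j\<in>{0..int n}. ?LR j \<omega>) + (\<Sum>i\<in>{0..<int n}. ?BT i \<omega>))"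
    proof (intro bexp_mono q)
      fix \<omega> assume "\<omega> \<subseteq> star_edges B"
      hence \<omega>: "\<omega> \<inter> star_edges B = \<omega>" by auto
      have nn: "0 \<le> (\<Sum>j\<in>{0..int n}. ?LR j \<omega>)" "0 \<le> (\<Sum>i\<in>{0..<int n}. ?BT i \<omega>)"
        by (auto intro: sum_nonneg)
      from crossing_duality[OF n(1), of \<omega>, folded B_def, unfolded \<omega>]
      show "1 \<le> (\<Sum>j\<in>{0..int n}. ?LR j \<omega>) + (\<Sum>i\<in>{0..<int n}. ?BT i \<omega>)"
      proof (elim disjE bexE)
        fix j assume j: "j \<in> {0..int n}" "reach (link tri_ends \<omega>) {(0, j)} {y. int n \<le> fst y}"
        hence "1 = ?LR j \<omega>" by simp
        also have "\<dots> \<le> (\<Sum>j\<in>{0..int n}. ?LR j \<omega>)"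
          using j by (intro member_le_sum[of _ _ "\<lambda>j. ?LR j \<omega>"]) auto
        finally show ?thesis
          using nn by linarith
      next
        fix i assume i: "i \<in> {0..<int n}" "reach (star_link B \<omega>) {(i, -1)} {y. int n - 1 \<le> snd y}"
        hence "1 = ?BT i \<omega>" by simp
        also have "\<dots> \<le> (\<Sum>i\<in>{0..<int n}. ?BT i \<omega>)"
          using i by (intro member_le_sum[of _ _ "\<lambda>i. ?BT i \<omega>"]) auto
        finally show ?thesis
          using nn by linarith
      qed
    qed
    also have "\<dots> = (\<Sum>j\<in>{0..int n}. bexp ?q (star_edges B) (?LR j))
        + (\<Sum>i\<in>{0..<int n}. bexp ?q (star_edges B) (?BT i))"
      by (simp only: bexp_add bexp_sum)
    also have "\<dots> \<le> (\<Sum>j\<in>{0..int n}. c ^ k) + (\<Sum>i\<in>{0..<int n}. c ^ k)"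
      by (intro add_mono sum_mono LR BT)
    also have "\<dots> = 2 * real L * (real k * c ^ k) + c ^ k"
      by (simp add: n_def algebra_simps)
    finally show ?thesis .
  qed
  have "(\<lambda>k. 2 * real L * (real k * c ^ k) + c ^ k) \<longlonglongrightarrow> 2 * real L * 0 + 0"
    using c0 c1 by (intro tendsto_intros powser_times_n_limit_0 LIMSEQ_power_zero) auto
  hence "eventually (\<lambda>k. 2 * real L * (real k * c ^ k) + c ^ k < 1) sequentially"
    by (rule order_tendstoD) simp
  moreover have "eventually (\<lambda>k::nat. 0 < k) sequentially"
    by (rule eventually_gt_at_top)
  ultimately have "eventually (\<lambda>k::nat. False) sequentially"
  proof eventually_elim
    case (elim k)
    thus False
      using main[of k] by linarith
  qed
  thus False by simp
qed

section \<open>Infinite clusters\<close>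

text \<open>The event is a finite disjoint union of cylinders, one for each state of F that
  satisfies P.\<close>

lemma bond_window_sets:
  assumes "finite F" "F \<subseteq> lattice_edges d"
  shows "{\<omega> \<in> space (bond_measure d p). P {e \<in> F. \<omega> e}} \<in> sets (bond_measure d p)"
    and "p \<in> {0..1} \<Longrightarrow> measure (bond_measure d p) {\<omega> \<in> space (bond_measure d p). P {e \<in> F. \<omega> e}}
      = bexp (\<lambda>_. p) F (\<lambda>\<omega>. of_bool (P \<omega>))"
proof -
  let ?M = "bond_measure d p"
  interpret product_prob_space "\<lambda>_. measure_pmf (bernoulli_pmf p)" "lattice_edges d"
    by (rule product_prob_spaceI) (rule measure_pmf.prob_space_axioms)
  \<comment> \<open>\<open>{e \<in> \<eta>}\<close> is the singleton of a truth value: the cylinder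
    prescribes for each edge of F whether it is open.\<close>
  define A where "A \<eta> = {\<omega> \<in> space ?M. \<forall>e\<in>F. \<omega> e \<in> {e \<in> \<eta>}}" for \<eta>
  have A_emb: "A \<eta> = emb (lattice_edges d) F (\<Pi>\<^sub>E e\<in>F. {e \<in> \<eta>})" for \<eta>
    unfolding A_def prod_emb_def bond_measure_def using assms by (auto simp: space_PiM Pi_iff)
  have A_sets: "A \<eta> \<in> sets ?M" for \<eta>
    unfolding A_emb bond_measure_def using assms by (intro sets_PiM_I) auto
  let ?I = "{\<eta> \<in> Pow F. P \<eta>}"
  have eq: "{\<omega> \<in> space ?M. P {e \<in> F. \<omega> e}} = (\<Union>\<eta>\<in>?I. A \<eta>)"
  proof (intro equalityI subsetI)
    fix \<omega> assume "\<omega> \<in> {\<omega> \<in> space ?M. P {e \<in> F. \<omega> e}}"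
    thus "\<omega> \<in> (\<Union>\<eta>\<in>?I. A \<eta>)"
      by (intro UN_I[of "{e \<in> F. \<omega> e}"]) (auto simp: A_def)
  next
    fix \<omega> assume "\<omega> \<in> (\<Union>\<eta>\<in>?I. A \<eta>)"
    then obtain \<eta> where \<eta>: "\<eta> \<subseteq> F" "P \<eta>" "\<omega> \<in> A \<eta>" by auto
    hence "{e \<in> F. \<omega> e} = \<eta>" by (auto simp: A_def)
    thus "\<omega> \<in> {\<omega> \<in> space ?M. P {e \<in> F. \<omega> e}}"
      using \<eta> by (auto simp: A_def)
  qed
  have fin: "finite ?I"
    using assms by simp
  show "{\<omega> \<in> space ?M. P {e \<in> F. \<omega> e}} \<in> sets ?M"
    unfolding eq using fin A_sets by (intro sets.finite_UN) auto
  assume p: "p \<in> {0..1}"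
  have A_measure: "measure ?M (A \<eta>) = (\<Prod>e\<in>F. if e \<in> \<eta> then p else 1 - p)" for \<eta>
  proof -
    have "measure ?M (A \<eta>) = (\<Prod>e\<in>F. measure (measure_pmf (bernoulli_pmf p)) {e \<in> \<eta>})"
      unfolding A_emb bond_measure_def using assms by (intro measure_PiM_emb) auto
    also have "\<dots> = (\<Prod>e\<in>F. if e \<in> \<eta> then p else 1 - p)"
      using p by (intro prod.cong) (auto simp: measure_pmf_single)
    finally show ?thesis .
  qed
  have disj: "disjoint_family_on A ?I"
    unfolding disjoint_family_on_def A_def by blast
  have "measure ?M (\<Union>\<eta>\<in>?I. A \<eta>) = (\<Sum>\<eta>\<in>?I. measure ?M (A \<eta>))"
    using fin A_sets disj unfolding bond_measure_def
    by (intro finite_measure_finite_Union) auto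
  also have "\<dots> = (\<Sum>\<eta>\<in>?I. (\<Prod>e\<in>F. if e \<in> \<eta> then p else 1 - p) * of_bool (P \<eta>))"
    by (intro sum.cong) (auto simp: A_measure)
  also have "\<dots> = bexp (\<lambda>_. p) F (\<lambda>\<omega>. of_bool (P \<omega>))"
    unfolding bexp_def using assms by (intro sum.mono_neutral_left) auto
  finally show "measure ?M {\<omega> \<in> space ?M. P {e \<in> F. \<omega> e}} = bexp (\<lambda>_. p) F (\<lambda>\<omega>. of_bool (P \<omega>))"
    by (simp only: eq)
qed

lemma connected_in_iff:
  "connected_in d \<omega> x y \<longleftrightarrow> (x, y) \<in> (link (\<lambda>e. e) {e \<in> lattice_edges d. \<omega> e})\<^sup>*"
proof -
  let ?R = "link (\<lambda>e. e) {e \<in> lattice_edges d. \<omega> e}"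
  have "(\<forall>j\<in>{1..n}. {xs (j - 1), xs j} \<in> lattice_edges d \<and> \<omega> {xs (j - 1), xs j})
      \<longleftrightarrow> (\<forall>i<n. (xs i, xs (Suc i)) \<in> ?R)" for n and xs :: "nat \<Rightarrow> vertex"
  proof -
    have "{1..n} = Suc ` {..<n}"
      by (simp add: image_Suc_lessThan)
    thus ?thesis
      by (auto simp: link_def)
  qed
  thus ?thesis
    unfolding connected_in_def rtrancl_power relpow_fun_conv by simp
qed

lemma open_cluster_eq:
  "open_cluster d \<omega> = {x. ((\<lambda>_. 0), x) \<in> (link (\<lambda>e. e) {e \<in> lattice_edges d. \<omega> e})\<^sup>*}"
proof -
  have "x \<in> lattice d" if "((\<lambda>_. 0), x) \<in> (link (\<lambda>e. e) {e \<in> lattice_edges d. \<omega> e})\<^sup>*" for x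
    using that
  proof (induction rule: rtrancl_induct)
    case base
    show ?case by (simp add: lattice_def)
  next
    case (step x y)
    thus ?case
      by (auto simp: link_def lattice_edges_iff)
  qed
  thus ?thesis
    by (auto simp: open_cluster_def connected_in_iff)
qed

definition exit_event :: "nat \<Rightarrow> real \<Rightarrow> vertex set \<Rightarrow> config set" where
  "exit_event d p \<Lambda> = {\<omega> \<in> space (bond_measure d p).
     reach (link (\<lambda>e. e) {e \<in> lattice_edges d. \<omega> e}) {\<lambda>_. 0} (- \<Lambda>)}"

lemma exit_event:
  assumes "finite \<Lambda>"
  shows "exit_event d p \<Lambda> \<in> sets (bond_measure d p)"
    and "p \<in> {0..1} \<Longrightarrow> measure (bond_measure d p) (exit_event d p \<Lambda>)
      = bexp (\<lambda>_. p) (lattice_graph.touching d \<Lambda>) (\<lambda>\<omega>. of_bool (reach (link (\<lambda>e. e) \<omega>) {\<lambda>_. 0} (- \<Lambda>)))"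
proof -
  let ?F = "lattice_graph.touching d \<Lambda>"
  have F: "finite ?F" "?F \<subseteq> lattice_edges d"
    using lattice_graph.finite_touching[OF assms] by (auto simp: lattice_graph.touching_def)
  have "{e \<in> lattice_edges d. \<omega> e} \<inter> ?F = {e \<in> ?F. \<omega> e}" for \<omega> :: config
    using F by auto
  hence eq: "exit_event d p \<Lambda> = {\<omega> \<in> space (bond_measure d p).
      reach (link (\<lambda>e. e) {e \<in> ?F. \<omega> e}) {\<lambda>_. 0} (- \<Lambda>)}"
    using lattice_graph.reach_touching_iff[of "{e \<in> lattice_edges d. _ e}" d \<Lambda> "\<lambda>_. 0"]
    by (auto simp: exit_event_def)
  show "exit_event d p \<Lambda> \<in> sets (bond_measure d p)"
    unfolding eq by (rule bond_window_sets[OF F])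
  show "measure (bond_measure d p) (exit_event d p \<Lambda>)
      = bexp (\<lambda>_. p) ?F (\<lambda>\<omega>. of_bool (reach (link (\<lambda>e. e) \<omega>) {\<lambda>_. 0} (- \<Lambda>)))" if "p \<in> {0..1}"
    unfolding eq using that by (rule bond_window_sets[OF F])
qed

lemma prob_space_bond_measure: "prob_space (bond_measure d p)"
  unfolding bond_measure_def by (intro prob_space_PiM measure_pmf.prob_space_axioms)

lemma infinite_cluster_subset:
  assumes "finite \<Lambda>"
  shows "{\<omega> \<in> space (bond_measure d p). infinite (open_cluster d \<omega>)} \<subseteq> exit_event d p \<Lambda>"
proof
  fix \<omega> assume \<omega>: "\<omega> \<in> {\<omega> \<in> space (bond_measure d p). infinite (open_cluster d \<omega>)}"
  hence "\<not> open_cluster d \<omega> \<subseteq> \<Lambda>"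
    using assms finite_subset by auto
  thus "\<omega> \<in> exit_event d p \<Lambda>"
    using \<omega> by (auto simp: exit_event_def reach_def open_cluster_eq)
qed

text \<open>Puts p = 0 into the set whose supremum is the critical point. Leaving the one-point box
  requires an open edge.\<close>

lemma theta_bond_zero: "theta_bond d 0 = 0"
proof -
  interpret prob_space "bond_measure d 0"
    by (rule prob_space_bond_measure)
  have zero: "bexp (\<lambda>_. 0) F f = f {}" if "finite F" for F :: "edge set" and f
    using that by (induction F rule: finite_induct) (simp_all add: bexp_insert)
  have fin: "finite {\<lambda>_::nat. 0::int}" by simp
  have "theta_bond d 0 \<le> measure (bond_measure d 0) (exit_event d 0 {\<lambda>_. 0})"
    unfolding theta_bond_def by (intro finite_measure_mono infinite_cluster_subset exit_event(1) fin)
  also have "\<dots> = 0"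
    by (simp add: exit_event(2) zero lattice_graph.finite_touching reach_def)
  finally show ?thesis
    by (simp add: theta_bond_def measure_le_0_iff)
qed

text \<open>The cluster is infinite iff it leaves every box of radius n. These exit events decrease
  in n, so continuity from above passes the uniform bound to the limit.\<close>

lemma theta_bond_ge:
  assumes p: "p \<in> {0..1}"
    and bound: "\<And>\<Lambda>. finite \<Lambda> \<Longrightarrow> C \<le> bexp (\<lambda>_. p) (lattice_graph.touching d \<Lambda>)
      (\<lambda>\<omega>. of_bool (reach (link (\<lambda>e. e) \<omega>) {\<lambda>_. 0} (- \<Lambda>)))"
  shows "C \<le> theta_bond d p"
proof -
  interpret prob_space "bond_measure d p"
    by (rule prob_space_bond_measure)
  define \<Lambda> where "\<Lambda> n = {x \<in> lattice d. \<forall>i<d. \<bar>x i\<bar> \<le> int n}" for n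
  have fin: "finite (\<Lambda> n)" for n
  proof -
    have "\<Lambda> n \<subseteq> {f. \<forall>i. (i \<in> {..<d} \<longrightarrow> f i \<in> {- int n..int n}) \<and> (i \<notin> {..<d} \<longrightarrow> f i = 0)}"
      by (auto simp: \<Lambda>_def lattice_def abs_le_iff minus_le_iff)
    thus ?thesis
      by (rule finite_subset) (intro finite_set_of_finite_funs; simp)
  qed
  have exhaust: "\<exists>n. A \<subseteq> \<Lambda> n" if A: "finite A" "A \<subseteq> lattice d" for A
  proof -
    define n where "n = (\<Sum>x\<in>A. \<Sum>i<d. nat \<bar>x i\<bar>)"
    have "nat \<bar>x i\<bar> \<le> n" if "x \<in> A" "i < d" for x i
    proof -
      have "nat \<bar>x i\<bar> \<le> (\<Sum>i<d. nat \<bar>x i\<bar>)"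
        using that by (intro member_le_sum) auto
      also have "\<dots> \<le> n"
        unfolding n_def using that A by (intro member_le_sum[where f = "\<lambda>x. \<Sum>i<d. nat \<bar>x i\<bar>"]) auto
      finally show ?thesis .
    qed
    hence "A \<subseteq> \<Lambda> n"
      using A(2) by (force simp: \<Lambda>_def)
    thus ?thesis ..
  qed
  let ?inf = "{\<omega> \<in> space (bond_measure d p). infinite (open_cluster d \<omega>)}"
  have "(\<Inter>n. exit_event d p (\<Lambda> n)) \<subseteq> ?inf"
  proof
    fix \<omega> assume \<omega>: "\<omega> \<in> (\<Inter>n. exit_event d p (\<Lambda> n))"
    have "\<not> open_cluster d \<omega> \<subseteq> \<Lambda> n" for n
      using \<omega> by (auto simp: exit_event_def reach_def open_cluster_eq)
    moreover have "open_cluster d \<omega> \<subseteq> lattice d"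
      by (auto simp: open_cluster_def)
    ultimately have "infinite (open_cluster d \<omega>)"
      using exhaust by blast
    thus "\<omega> \<in> ?inf"
      using \<omega> by (auto simp: exit_event_def)
  qed
  hence inf: "?inf = (\<Inter>n. exit_event d p (\<Lambda> n))"
    using infinite_cluster_subset[OF fin] by blast
  have "decseq (\<lambda>n. exit_event d p (\<Lambda> n))"
  proof (rule antimonoI)
    fix m n :: nat assume "m \<le> n"
    hence "- \<Lambda> n \<subseteq> - \<Lambda> m"
      by (force simp: \<Lambda>_def)
    thus "exit_event d p (\<Lambda> n) \<subseteq> exit_event d p (\<Lambda> m)"
      by (auto simp: exit_event_def reach_def)
  qed
  hence "(\<lambda>n. measure (bond_measure d p) (exit_event d p (\<Lambda> n)))
      \<longlonglongrightarrow> measure (bond_measure d p) (\<Inter>n. exit_event d p (\<Lambda> n))"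
    using exit_event(1)[OF fin] by (intro finite_Lim_measure_decseq) auto
  hence "(\<lambda>n. measure (bond_measure d p) (exit_event d p (\<Lambda> n))) \<longlonglongrightarrow> theta_bond d p"
    by (simp only: theta_bond_def inf)
  thus ?thesis
    using bound[OF fin] exit_event(2)[OF fin p] by (intro LIMSEQ_le_const) auto
qed

section \<open>The critical surface\<close>

text \<open>Residue class k corresponds to the index i = 2 - k in the equation for the critical
  value.\<close>

lemma multiplicity3_eq: "k < 3 \<Longrightarrow> multiplicity3 d k = (d + (2 - k)) div 3"
proof (induction d)
  case 0
  thus ?case by (simp add: multiplicity3_def)
next
  case (Suc d)
  have "{i. i < Suc d \<and> i mod 3 = k} = (if d mod 3 = k then insert d {i. i < d \<and> i mod 3 = k}
      else {i. i < d \<and> i mod 3 = k})"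
    by (auto simp: less_Suc_eq)
  hence "multiplicity3 d k + (if d mod 3 = k then 1 else 0) = multiplicity3 (Suc d) k"
    by (simp add: multiplicity3_def)
  moreover have "(Suc d + (2 - k)) div 3 = (d + (2 - k)) div 3 + (if d mod 3 = k then 1 else 0)"
  proof -
    consider "k = 0" | "k = 1" | "k = 2"
      using Suc.prems by linarith
    thus ?thesis
      by cases (simp_all, presburger+)
  qed
  ultimately show ?case
    using Suc by simp
qed

text \<open>The critical surface of the triangular lattice is where this equals 1. The base point 0
  is a representative, the probabilities being translation invariant.\<close>

definition surplus :: "nat \<Rightarrow> real \<Rightarrow> real" where
  "surplus d p = (let q = (\<lambda>k. tri_prob d p (k, 0)) in q 0 + q 1 + q 2 - q 0 * q 1 * q 2)"

text \<open>With u_i = 1 - q_(2-i) the equation reads q_0 q_1 q_2 = 2 - (3 - q_0 - q_1 -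
  q_2).\<close>

lemma pstar_equation_iff: "pstar_equation d p \<longleftrightarrow> surplus d p = 1"
proof -
  define u where "u i = (1 - p) ^ ((d + i) div 3)" for i
  have "nat \<lfloor>(real d + real i) / 3\<rfloor> = (d + i) div 3" for i
    using floor_divide_of_nat_eq[of "d + i" 3, where ?'a = real] by simp
  moreover have "{0..2::nat} = {0, 1, 2}"
    by auto
  ultimately have "pstar_equation d p \<longleftrightarrow> (1 - u 0) * (1 - u 1) * (1 - u 2) = 2 - (u 0 + u 1 + u 2)"
    by (simp add: pstar_equation_def u_def mult.assoc add.assoc)
  moreover have "tri_prob d p (0, 0) = 1 - u 2" "tri_prob d p (1, 0) = 1 - u 1" "tri_prob d p (2, 0) = 1 - u 0"
    by (simp_all add: tri_prob_def u_def multiplicity3_eq)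
  ultimately show ?thesis
    unfolding surplus_def Let_def by (simp only:) (auto simp: algebra_simps)
qed

text \<open>The three probabilities are raised one after the other, and each increment is multiplied
  by one minus the product of the other two. The increments are positive because d \<ge> 3 gives
  every direction a coordinate.\<close>

lemma surplus_strict_mono:
  assumes "d \<ge> 3" "0 \<le> p" "p < r" "r \<le> 1"
  shows "surplus d p < surplus d r"
proof -
  define x y where "x k = tri_prob d p (k, 0)" and "y k = tri_prob d r (k, 0)" for k
  have xy: "0 \<le> x k \<and> x k < y k \<and> y k \<le> 1" if "k < 3" for k
  proof -
    have "0 < multiplicity3 d k"
      using assms that by (simp add: multiplicity3_eq div_greater_zero_iff)
    hence "(1 - r) ^ multiplicity3 d k < (1 - p) ^ multiplicity3 d k"
      using assms by (intro power_strict_mono) auto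
    thus ?thesis
      using assms by (simp add: x_def y_def tri_prob_def power_le_one)
  qed
  note xy = xy[of 0] xy[of 1] xy[of 2]
  \<comment> \<open>Both factors lie strictly below 1, so the first of the three terms is positive;
    the other two are nonnegative.\<close>
  have "x 1 * x 2 < 1"
    using xy mult_le_one[of "x 1" "x 2"] mult_strict_mono[of "x 1" 1 "x 2" 1] by auto
  moreover have "y 0 * x 2 \<le> 1" "y 0 * y 1 \<le> 1"
    using xy by (auto intro!: mult_le_one)
  ultimately have "0 < (y 0 - x 0) * (1 - x 1 * x 2) + (y 1 - x 1) * (1 - y 0 * x 2)
      + (y 2 - x 2) * (1 - y 0 * y 1)"
    using xy by (intro add_pos_nonneg mult_pos_pos mult_nonneg_nonneg) auto
  also have "\<dots> = surplus d r - surplus d p"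
    by (simp add: surplus_def Let_def x_def y_def algebra_simps)
  finally show ?thesis by simp
qed

text \<open>\<open>surplus d\<close> is continuous and strictly increasing, from 0 at p = 0 to 2 at
  p = 1.\<close>

lemma pstar_unique:
  assumes "d \<ge> 3"
  shows "\<exists>!p. p \<in> {0<..<1} \<and> pstar_equation d p"
proof (rule ex_ex1I)
  have m: "0 < multiplicity3 d k" if "k < 3" for k
    using assms that by (simp add: multiplicity3_eq div_greater_zero_iff)
  have "surplus d 0 = 0" "surplus d 1 = 2"
    using m[of 0] m[of 1] m[of 2] by (simp_all add: surplus_def Let_def tri_prob_def power_0_left)
  moreover have "continuous_on {0..1} (surplus d)"
    unfolding surplus_def Let_def tri_prob_def by (intro continuous_intros)
  ultimately obtain p where "0 \<le> p" "p \<le> 1" "surplus d p = 1"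
    using IVT'[of "surplus d" 0 1 1] by auto
  moreover have "p \<noteq> 0" "p \<noteq> 1"
    using calculation \<open>surplus d 0 = 0\<close> \<open>surplus d 1 = 2\<close> by auto
  ultimately show "\<exists>p. p \<in> {0<..<1} \<and> pstar_equation d p"
    by (intro exI[of _ p]) (auto simp: pstar_equation_iff)
next
  fix p r assume "p \<in> {0<..<1} \<and> pstar_equation d p" "r \<in> {0<..<1} \<and> pstar_equation d r"
  thus "p = r"
    using surplus_strict_mono[OF assms, of p r] surplus_strict_mono[OF assms, of r p]
    by (cases p r rule: linorder_cases) (auto simp: pstar_equation_iff)
qed

text \<open>From \<open>pstar d\<close> up to p the surplus is at least 1, so
  \<open>phi_ge_one\<close> holds on the whole interval and the integrated differential inequality
  gives a positive lower bound.\<close>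

lemma theta_bond_pos:
  assumes d: "d \<ge> 3" and p: "pstar d < p" "p \<le> 1"
  shows "0 < theta_bond d p"
proof -
  have "pstar d \<in> {0<..<1} \<and> pstar_equation d (pstar d)"
    unfolding pstar_def by (rule theI'[OF pstar_unique[OF d]])
  hence s: "0 < pstar d" "surplus d (pstar d) = 1"
    by (auto simp: pstar_equation_iff)
  have "1 - exp (pstar d - p) \<le> theta_bond d p"
  proof (rule theta_bond_ge)
    fix \<Lambda> :: "vertex set" assume "finite \<Lambda>"
    thus "1 - exp (pstar d - p) \<le> bexp (\<lambda>_. p) (lattice_graph.touching d \<Lambda>)
        (\<lambda>\<omega>. of_bool (reach (link (\<lambda>e. e) \<omega>) {\<lambda>_. 0} (- \<Lambda>)))"
    proof (rule lattice_graph.exit_probability_ge)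
      fix r and S :: "vertex set" assume r: "pstar d \<le> r" "r \<le> p" and S: "finite S" "(\<lambda>_. 0) \<in> S"
      have "1 \<le> surplus d r"
        using surplus_strict_mono[OF d, of "pstar d" r] s r p by (cases "r = pstar d") auto
      thus "1 \<le> lattice_graph.phi d r (\<lambda>_. 0) S"
        using r s p by (intro phi_ge_one d S) (auto simp: surplus_def Let_def tri_prob_def)
    qed (use s p in auto)
  qed (use s p in auto)
  thus ?thesis
    using p by (smt (verit) exp_less_one_iff)
qed

theorem theorem2p1:
  fixes d :: nat
  assumes "d \<ge> 3"
  shows "(\<exists>!p. p \<in> {0<..<1} \<and> pstar_equation d p) \<and> pc_bond d \<le> pstar d"
proof
  show "\<exists>!p. p \<in> {0<..<1} \<and> pstar_equation d p"
    using assms by (rule pstar_unique)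
  show "pc_bond d \<le> pstar d"
    unfolding pc_bond_def
  proof (rule cSup_least)
    show "{p \<in> {0..1}. theta_bond d p = 0} \<noteq> {}"
      using theta_bond_zero by (intro ex_in_conv[THEN iffD1] exI[of _ 0]) auto
    show "p \<le> pstar d" if "p \<in> {p \<in> {0..1}. theta_bond d p = 0}" for p
      using that theta_bond_pos[OF assms, of p] by (cases "p \<le> pstar d") auto
  qed
qed

end
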